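(* Let $n\geq1$ be an integer and let $a,b,c,d\in\mathbf{R}$ with $ad-bc=1$ and $b>0$. Let $f\in L^2(\mathbf{R}^n,\mathbf{C}^{(n)})$ be such that its linear canonical transform $F^{(a,b,c,d)}$ belongs to $L^1(\mathbf{R}^n,\mathbf{C}^{(n)})$, and let $g(\underline{t})=e^{\mathbf{i}\frac{a}{2b}|\underline{t}|^2}f(\underline{t})$ for $\underline{t}\in\mathbf{R}^n$. For $x_0>0$ and $\underline{x}\in\mathbf{R}^n$ define $$f_{\mathscr{M}}^{(a,b)}(x_0+\underline{x}):=\frac{e^{-\mathbf{i}\frac{a}{2b}|x_0+\underline{x}|^2}}{(\sqrt{-\mathbf{i}2\pi b})^{\,n}}\int_{\mathbf{R}^n}e^{-\frac{x_0}{b}|\underline{\xi}|}\,e^{\mathbf{i}\frac1b\langle\underline{x},\underline{\xi}\rangle}\left(1+\mathbf{i}\frac{\underline{\xi}}{|\underline{\xi}|}\right)F^{(a,b,c,d)}(\underline{\xi})\,e^{-\mathbf{i}\frac{d}{2b}|\underline{\xi}|^2}\,d\underline{\xi}.$$ Then for all $x_0>0$ and $\underline{x}\in\mathbf{R}^n$, $$f_{\mathscr{M}}^{(a,b)}(x_0+\underline{x})=e^{-\mathbf{i}\frac{a}{2b}|x_0+\underline{x}|^2}\left[g(x_0+\underline{x})+h(x_0+\underline{x})\right],$$ where $$g(x_0+\underline{x})=\int_{\mathbf{R}^n}P_{x_0}(\underline{x}-\underline{t})\,g(\underline{t})\,d\underline{t},\qquad h(x_0+\underline{x})=\int_{\mathbf{R}^n}Q_{x_0}(\underline{x}-\underline{t})\,g(\underline{t})\,d\underline{t},$$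 and $$P_{x_0}(\underline{x})=\frac{\Gamma(\frac{n+1}{2})}{\pi^{\frac{n+1}{2}}}\frac{x_0}{|x_0+\underline{x}|^{n+1}},\qquad Q_{x_0}(\underline{x})=\frac{\Gamma(\frac{n+1}{2})}{\pi^{\frac{n+1}{2}}}\frac{\overline{\underline{x}}}{|x_0+\underline{x}|^{n+1}}$$ are the Poisson and conjugate Poisson kernels, respectively.
   Context: $\mathbf{C}^{(n)}$ is the complex Clifford algebra: the associative unital algebra over $\mathbf{C}$ generated by $\mathbf{e}_1,\dots,\mathbf{e}_n$ with $\mathbf{e}_i\mathbf{e}_j+\mathbf{e}_j\mathbf{e}_i=-2\delta_{ij}$; it has basis $\mathbf{e}_S=\mathbf{e}_{i_1}\cdots\mathbf{e}_{i_l}$, $S=\{i_1<\dots<i_l\}\subseteq\{1,\dots,n\}$, $\mathbf{e}_\emptyset=1$. The complex unit $\mathbf{i}$ commutes with all $\mathbf{e}_j$. The norm of $x=\sum_S x_S\mathbf{e}_S$ is $|x|=(\sum_S|x_S|^2)^{1/2}$. The space $\mathbf{R}^n$ is identified with $\{\underline{x}=x_1\mathbf{e}_1+\cdots+x_n\mathbf{e}_n: x_j\in\mathbf{R}\}\subset\mathbf{C}^{(n)}$, with $\langle\underline{x},\underline{\xi}\rangle=\sum_j x_j\xi_j$. A para-vector is $x_0+\underline{x}$ with $x_0\in\mathbf{R}$, $\underline{x}\in\mathbf{R}^n$; thus $|x_0+\underline{x}|^2=x_0^2+|\underline{x}|^2$, and its conjugate is $\overline{x_0+\underline{x}}=x_0-\underline{x}$,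 so $\overline{\underline{x}}=-\underline{x}$. $L^p(\mathbf{R}^n,\mathbf{C}^{(n)})$ ($p=1,2$) denotes the integrable, respectively square integrable, $\mathbf{C}^{(n)}$-valued functions on $\mathbf{R}^n$. Integrals of $\mathbf{C}^{(n)}$-valued functions are taken componentwise, and products in integrands are Clifford products in the written order. For nonzero complex $z$, $\sqrt z=|z|^{1/2}e^{\mathbf{i}\arg z/2}$ with $\arg z\in(-\pi,\pi]$. The linear canonical transform (LCT) of $f\in L^1(\mathbf{R}^n,\mathbf{C}^{(n)})$ is $$F^{(a,b,c,d)}(\underline{\xi}):=\int_{\mathbf{R}^n}\frac{1}{(\sqrt{\mathbf{i}2\pi b})^{\,n}}\,e^{\mathbf{i}\left(\frac{d}{2b}|\underline{\xi}|^2-\frac1b\langle\underline{\xi},\underline{x}\rangle+\frac{a}{2b}|\underline{x}|^2\right)}f(\underline{x})\,d\underline{x}.$$ As in the one-dimensional case, it extends by Plancherel's theorem from $L^1\cap L^2$ to an isometry of $L^2(\mathbf{R}^n,\mathbf{C}^{(n)})$; for $f\in L^2(\mathbf{R}^n,\mathbf{C}^{(n)})$, $F^{(a,b,c,d)}$ denotes this extension. The symbol $g$ is used both for the function on $\mathbf{R}^n$ and for its Poisson extension $g(x_0+\underline{x})$ to $x_0>0$. *)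

theory Defs
  imports "HOL-Analysis.Analysis"
begin

section \<open>The complex Clifford algebra\<close>

text \<open>
  The generators are indexed by a finite linearly ordered type \<open>'n\<close>, with \<open>n = CARD('n)\<close>.
  An element is stored as its family of coordinates with respect to the basis \<open>e\<^sub>S\<close>, so that
  the norm of \<^typ>\<open>(complex, 'n set) vec\<close> is the Clifford norm, and Bochner integration is
  componentwise.

  Pitfall: the library operations \<open>1\<close> and \<open>*\<close> on \<open>vec\<close> are the pointwise ones.
  The Clifford unit is \<open>cblade {}\<close> and the Clifford product is written \<open>\<odot>\<close> below.
\<close>

type_synonym 'n clifford = "(complex, 'n set) vec"

definition cblade :: "'n set \<Rightarrow> ('n::finite) clifford" where
  "cblade S = axis S 1"

text \<open>
  \<open>e\<^sub>A e\<^sub>B = csign A B e\<^sub>C\<close>, where \<open>C\<close> is the symmetric difference of \<open>A\<close> and \<open>B\<close>: sorting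
  the product costs one factor \<open>-1\<close> for each pair \<open>i \<in> A\<close>, \<open>j \<in> B\<close> with \<open>j < i\<close>, and each
  \<open>i \<in> A \<inter> B\<close> contributes \<open>e\<^sub>i\<^sup>2 = -1\<close>.
\<close>

definition csign :: "('n::{finite,linorder}) set \<Rightarrow> 'n set \<Rightarrow> complex" where
  "csign A B = (-1) ^ card {(i, j). i \<in> A \<and> j \<in> B \<and> j \<le> i}"

definition cmult :: "('n::{finite,linorder}) clifford \<Rightarrow> 'n clifford \<Rightarrow> 'n clifford"
    (infixl "\<odot>" 70) where
  "x \<odot> y = (\<Sum>A\<in>UNIV. \<Sum>B\<in>UNIV. (csign A B * x $ A * y $ B) *s cblade (sym_diff A B))"

definition cvec :: "real ^ 'n \<Rightarrow> ('n::finite) clifford" where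
  "cvec x = (\<Sum>j\<in>UNIV. complex_of_real (x $ j) *s cblade {j})"

definition paravec :: "real \<Rightarrow> real ^ 'n \<Rightarrow> ('n::finite) clifford" where
  "paravec x0 x = complex_of_real x0 *s cblade {} + cvec x"

definition paravec_conj :: "real \<Rightarrow> real ^ 'n \<Rightarrow> ('n::finite) clifford" where
  "paravec_conj x0 x = complex_of_real x0 *s cblade {} - cvec x"


subsection \<open>The defining properties of the Clifford algebra\<close>

lemma cblade_nth: "cblade S $ T = (if T = S then 1 else 0)"
  by (simp add: cblade_def axis_def)

lemma neg_one_power_card_sym_diff:
  assumes "finite X" "finite Y"
  shows "(-1::complex) ^ card (sym_diff X Y) = (-1) ^ card X * (-1) ^ card Y"
proof -
  have X: "card X = card (X - Y) + card (X \<inter> Y)"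
    using assms by (metis card_Diff_subset_Int card_mono finite_Int inf_le1 le_add_diff_inverse2)
  have Y: "card Y = card (Y - X) + card (X \<inter> Y)"
    using assms by (metis card_Diff_subset_Int card_mono finite_Int inf_le1 inf_commute le_add_diff_inverse2)
  have S: "card (sym_diff X Y) = card (X - Y) + card (Y - X)"
    using assms by (intro card_Un_disjoint) auto
  have "(-1::complex) ^ card (X \<inter> Y) * (-1) ^ card (X \<inter> Y) = 1"
    by (simp flip: power_mult_distrib)
  then show ?thesis
    unfolding X Y S power_add by (simp add: algebra_simps)
qed

lemma csign_sym_diff_left: "csign (sym_diff A B) C = csign A C * csign B C"
proof -
  have "{(i, j). i \<in> sym_diff A B \<and> j \<in> C \<and> j \<le> i} =
        sym_diff {(i, j). i \<in> A \<and> j \<in> C \<and> j \<le> i} {(i, j). i \<in> B \<and> j \<in> C \<and> j \<le> i}"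
    by auto
  then show ?thesis
    by (simp add: csign_def neg_one_power_card_sym_diff)
qed

lemma csign_sym_diff_right: "csign A (sym_diff B C) = csign A B * csign A C"
proof -
  have "{(i, j). i \<in> A \<and> j \<in> sym_diff B C \<and> j \<le> i} =
        sym_diff {(i, j). i \<in> A \<and> j \<in> B \<and> j \<le> i} {(i, j). i \<in> A \<and> j \<in> C \<and> j \<le> i}"
    by auto
  then show ?thesis
    by (simp add: csign_def neg_one_power_card_sym_diff)
qed

lemma cmult_nth: "(x \<odot> y) $ S = (\<Sum>A\<in>UNIV. csign A (sym_diff A S) * x $ A * y $ sym_diff A S)"
proof -
  have eq: "(S = sym_diff A B) = (B = sym_diff A S)" for A B :: "'a set"
    by auto
  show ?thesis
    unfolding cmult_def by (simp add: cblade_nth eq if_distrib cong: if_cong)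
qed

lemma cmult_add_left: "(x + y) \<odot> z = x \<odot> z + y \<odot> z"
  by (simp add: vec_eq_iff cmult_nth algebra_simps sum.distrib)

lemma cmult_add_right: "x \<odot> (y + z) = x \<odot> y + x \<odot> z"
  by (simp add: vec_eq_iff cmult_nth algebra_simps sum.distrib)

lemma cmult_scale_left: "(c *s x) \<odot> y = c *s (x \<odot> y)"
  by (simp add: vec_eq_iff cmult_nth sum_distrib_left algebra_simps)

lemma cmult_scale_right: "x \<odot> (c *s y) = c *s (x \<odot> y)"
  by (simp add: vec_eq_iff cmult_nth sum_distrib_left algebra_simps)

lemma cmult_one_left: "cblade {} \<odot> x = x"
  by (simp add: vec_eq_iff cmult_nth cblade_nth csign_def if_distrib if_distribR cong: if_cong)

lemma cmult_one_right: "x \<odot> cblade {} = x"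
proof -
  have "csign A (sym_diff A S) * x $ A * cblade {} $ sym_diff A S = (if A = S then x $ S else 0)"
    for A S :: "'a set"
  proof (cases "A = S")
    case True
    then show ?thesis by (simp add: cblade_nth csign_def)
  next
    case False
    then have "sym_diff A S \<noteq> {}" by auto
    then show ?thesis using False by (simp only: cblade_nth if_False mult_zero_right)
  qed
  then show ?thesis
    by (simp only: vec_eq_iff cmult_nth) simp
qed

lemma cmult_assoc: "(x \<odot> y) \<odot> z = x \<odot> (y \<odot> z)"
proof -
  have "((x \<odot> y) \<odot> z) $ S = (x \<odot> (y \<odot> z)) $ S" for S
  proof -
    define T where "T A B = csign A B * csign A (sym_diff B (sym_diff A S)) *
        csign B (sym_diff B (sym_diff A S)) * x $ A * y $ B * z $ sym_diff B (sym_diff A S)" for A B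
    have "((x \<odot> y) \<odot> z) $ S = (\<Sum>C\<in>UNIV. \<Sum>A\<in>UNIV. T A (sym_diff A C))"
    proof -
      have "sym_diff (sym_diff A C) (sym_diff A S) = sym_diff C S"
           "sym_diff A (sym_diff A C) = C" for A C :: "'a set"
        by auto
      moreover have "csign C D = csign A D * csign (sym_diff A C) D" for A C D :: "'a set"
        by (subst csign_sym_diff_left [symmetric], rule arg_cong [of _ _ "\<lambda>X. csign X D"]) auto
      ultimately show ?thesis
        unfolding cmult_nth [of "x \<odot> y"] cmult_nth [of x y] T_def sum_distrib_left sum_distrib_right
        by (intro sum.cong refl) (simp add: mult.assoc mult.left_commute)
    qed
    also have "\<dots> = (\<Sum>A\<in>UNIV. \<Sum>C\<in>UNIV. T A (sym_diff A C))"
      by (rule sum.swap)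
    also have "\<dots> = (\<Sum>A\<in>UNIV. \<Sum>B\<in>UNIV. T A B)"
      by (intro sum.cong refl sum.reindex_bij_witness [where i = "sym_diff A" and j = "sym_diff A" for A])
         auto
    also have "\<dots> = (x \<odot> (y \<odot> z)) $ S"
    proof -
      have "csign A (sym_diff A S) = csign A B * csign A (sym_diff B (sym_diff A S))"
        for A B :: "'a set"
        by (subst csign_sym_diff_right [symmetric], rule arg_cong [of _ _ "csign A"]) auto
      then show ?thesis
        unfolding cmult_nth [of x] cmult_nth [of y] T_def sum_distrib_left
        by (intro sum.cong refl) (simp add: mult.assoc mult.left_commute)
    qed
    finally show ?thesis .
  qed
  then show ?thesis
    by (simp add: vec_eq_iff)
qed

lemma cblade_mult: "cblade A \<odot> cblade B = csign A B *s cblade (sym_diff A B)"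
proof -
  have eq: "(csign X Y * cblade A $ X * cblade B $ Y) *s cblade (sym_diff X Y) =
    (if Y = B then if X = A then csign A B *s cblade (sym_diff A B) else 0 else 0)" for X Y
    by (simp add: cblade_nth)
  show ?thesis
    unfolding cmult_def eq by simp
qed

lemma cgenerator_relation:
  "cblade {i} \<odot> cblade {j} + cblade {j} \<odot> cblade {i} = (if i = j then -2 else 0) *s cblade {}"
proof -
  have *: "{(i', j'). i' = i \<and> j' = j \<and> j' \<le> i'} = (if j \<le> i then {(i, j)} else {})" for i j :: 'a
    by auto
  have "csign {i} {j} = (if j \<le> i then -1 else 1)" for i j :: 'a
    by (simp add: csign_def *)
  moreover have "sym_diff {i} {j} = (if i = j then {} else {i, j})"
    "sym_diff {j} {i} = (if i = j then {} else {i, j})"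
    by auto
  ultimately show ?thesis
    unfolding cblade_mult by (auto simp: vec_eq_iff)
qed

lemma cblade_insert_less:
  assumes "\<And>j. j \<in> S \<Longrightarrow> i < j"
  shows "cblade (insert i S) = cblade {i} \<odot> cblade S"
proof -
  have "{(i', j). i' \<in> {i} \<and> j \<in> S \<and> j \<le> i'} = {}"
    by (auto dest: assms simp: not_less [symmetric])
  then have "csign {i} S = 1"
    by (simp only: csign_def) simp
  moreover have "sym_diff {i} S = insert i S"
    using assms by auto
  ultimately show ?thesis
    by (simp add: cblade_mult)
qed

lemma norm_paravec: "(norm (paravec x0 x))\<^sup>2 = x0\<^sup>2 + (norm x)\<^sup>2"
proof -
  have empty: "paravec x0 x $ {} = of_real x0"
    by (simp add: paravec_def cvec_def cblade_nth)
  have single: "paravec x0 x $ {j} = of_real (x $ j)" for j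
    by (simp add: paravec_def cvec_def cblade_nth if_distrib cong: if_cong)
  have other: "paravec x0 x $ S = 0" if "S \<notin> insert {} (range (\<lambda>j. {j}))" for S
    using that
    by (auto simp: paravec_def cvec_def cblade_nth intro!: sum.neutral split: if_splits)
  have "(norm (paravec x0 x))\<^sup>2 = (\<Sum>S\<in>UNIV. (norm (paravec x0 x $ S))\<^sup>2)"
    by (simp add: norm_vec_def L2_set_def sum_nonneg)
  also have "\<dots> = (\<Sum>S\<in>insert {} (range (\<lambda>j. {j})). (norm (paravec x0 x $ S))\<^sup>2)"
    by (rule sum.mono_neutral_right) (use other in auto)
  also have "\<dots> = x0\<^sup>2 + (\<Sum>S\<in>range (\<lambda>j. {j}). (norm (paravec x0 x $ S))\<^sup>2)"
    by (subst sum.insert) (auto simp: empty)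
  also have "\<dots> = x0\<^sup>2 + (\<Sum>j\<in>UNIV. (x $ j)\<^sup>2)"
    by (subst sum.reindex) (auto simp: single inj_on_def)
  also have "\<dots> = x0\<^sup>2 + (norm x)\<^sup>2"
    by (simp add: norm_vec_def L2_set_def sum_nonneg)
  finally show ?thesis .
qed

lemma paravec_conj_zero: "paravec_conj 0 x = - cvec x"
  by (simp add: paravec_conj_def)


section \<open>The linear canonical transform\<close>

definition square_integrable :: "('a::euclidean_space \<Rightarrow> 'b::euclidean_space) \<Rightarrow> bool" where
  "square_integrable f \<longleftrightarrow>
     f \<in> borel_measurable lebesgue \<and> integrable lebesgue (\<lambda>x. (norm (f x))\<^sup>2)"

text \<open>
  \<^const>\<open>csqrt\<close> is the principal branch, with argument in \<open>(-\<pi>, \<pi>]\<close>.  The parameter \<open>c\<close> enters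
  only through \<open>a * d - b * c = 1\<close>.
\<close>

definition lct :: "real \<Rightarrow> real \<Rightarrow> real \<Rightarrow> real \<Rightarrow> (real ^ 'n \<Rightarrow> 'n clifford) \<Rightarrow>
    real ^ 'n \<Rightarrow> ('n::finite) clifford" where
  "lct a b c d f \<xi> = (LINT x|lebesgue.
     (1 / csqrt (\<i> * 2 * pi * b) ^ CARD('n) *
       exp (\<i> * complex_of_real (d / (2 * b) * (norm \<xi>)\<^sup>2 - 1 / b * (\<xi> \<bullet> x)
                               + a / (2 * b) * (norm x)\<^sup>2))) *s f x)"

text \<open>
  \<open>F\<close> is (a representative of) the value at \<open>f\<close> of the continuous extension of \<^const>\<open>lct\<close> from
  \<open>L\<^sup>1 \<inter> L\<^sup>2\<close> to \<open>L\<^sup>2\<close>: it is the \<open>L\<^sup>2\<close>-limit of the transforms of some sequence in \<open>L\<^sup>1 \<inter> L\<^sup>2\<close>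
  converging to \<open>f\<close> in \<open>L\<^sup>2\<close>.  By Plancherel's theorem, such an \<open>F\<close> exists, is unique up to null
  sets, and does not depend on the sequence.
\<close>

definition is_lct_L2 :: "real \<Rightarrow> real \<Rightarrow> real \<Rightarrow> real \<Rightarrow> (real ^ 'n \<Rightarrow> 'n clifford) \<Rightarrow>
    (real ^ 'n \<Rightarrow> ('n::finite) clifford) \<Rightarrow> bool" where
  "is_lct_L2 a b c d f F \<longleftrightarrow>
     square_integrable f \<and> square_integrable F \<and>
     (\<exists>u. (\<forall>k. integrable lebesgue (u k) \<and> square_integrable (u k)) \<and>
       (\<lambda>k. \<integral>\<^sup>+x. ennreal ((norm (u k x - f x))\<^sup>2) \<partial>lebesgue) \<longlonglongrightarrow> 0 \<and>
       (\<lambda>k. \<integral>\<^sup>+\<xi>. ennreal ((norm (lct a b c d (u k) \<xi> - F \<xi>))\<^sup>2) \<partial>lebesgue) \<longlonglongrightarrow> 0)"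

text \<open>
  The function \<open>f\<^sub>M\<close> of the para-vector \<open>x0 + x\<close>, expressed through the transform \<open>F\<close> of \<open>f\<close>.
  The convention \<open>\<xi> / 0 = 0\<close> affects the integrand only at the null set \<open>{0}\<close>.
\<close>

definition monogenic_lct :: "real \<Rightarrow> real \<Rightarrow> real \<Rightarrow> ((real, 'n) vec \<Rightarrow> 'n clifford) \<Rightarrow>
    real \<Rightarrow> (real, 'n) vec \<Rightarrow> ('n::{finite,linorder}) clifford" where
  "monogenic_lct a b d F x0 x =
     (exp (- \<i> * complex_of_real (a / (2 * b) * (norm (paravec x0 x))\<^sup>2)) /
        csqrt (- \<i> * 2 * pi * b) ^ CARD('n)) *s
     (LINT \<xi>|lebesgue.
        (exp (complex_of_real (- (x0 / b) * norm \<xi>)) *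
           exp (\<i> * complex_of_real (1 / b * (x \<bullet> \<xi>)))) *s
        ((cblade {} + \<i> *s cvec (\<xi> /\<^sub>R norm \<xi>)) \<odot>
         (exp (- \<i> * complex_of_real (d / (2 * b) * (norm \<xi>)\<^sup>2)) *s F \<xi>)))"


section \<open>Poisson and conjugate Poisson kernels\<close>

definition poisson_kernel :: "real \<Rightarrow> real ^ 'n::finite \<Rightarrow> real" where
  "poisson_kernel x0 x =
     Gamma ((real CARD('n) + 1) / 2) / pi powr ((real CARD('n) + 1) / 2) *
       (x0 / norm (paravec x0 x) ^ (CARD('n) + 1))"

definition conj_poisson_kernel :: "real \<Rightarrow> real ^ 'n \<Rightarrow> ('n::finite) clifford" where
  "conj_poisson_kernel x0 x =
     (Gamma ((real CARD('n) + 1) / 2) / pi powr ((real CARD('n) + 1) / 2)) *\<^sub>R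
       (paravec_conj 0 x /\<^sub>R norm (paravec x0 x) ^ (CARD('n) + 1))"

definition poisson_ext :: "(real ^ 'n \<Rightarrow> 'n clifford) \<Rightarrow> real \<Rightarrow> real ^ 'n \<Rightarrow>
    ('n::finite) clifford" where
  "poisson_ext g x0 x = (LINT t|lebesgue. poisson_kernel x0 (x - t) *\<^sub>R g t)"

definition conj_poisson_ext :: "((real, 'n) vec \<Rightarrow> 'n clifford) \<Rightarrow> real \<Rightarrow> (real, 'n) vec \<Rightarrow>
    ('n::{finite,linorder}) clifford" where
  "conj_poisson_ext g x0 x = (LINT t|lebesgue. conj_poisson_kernel x0 (x - t) \<odot> g t)"

end

theory Submission
  imports Defs "HOL-Probability.Characteristic_Functions" "HOL-Probability.Sinc_Integral"
    "HOL-Real_Asymp.Real_Asymp"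
begin

text \<open>
  The integrand of \<open>f\<^sub>M\<close> pairs the transform \<open>F\<close> with the function
  \<open>E\<^sub>y\<^sub>,\<^sub>z(\<xi>) = e\<^bsup>-y|\<xi>|\<^esup> e\<^bsup>i\<langle>z,\<xi>\<rangle>\<^esup> (1 + i\<xi>/|\<xi>|)\<close> at \<open>y = x0/b\<close>, \<open>z = x/b\<close>
  (\<open>monogenic_exponential\<close>), and the bracket on the right pairs \<open>g\<close> with the sum of the two
  Poisson kernels, which is a multiple of the Cauchy kernel:
  \<open>P + Q = c\<^sub>n (x0 - x)/|x0 + x|\<^bsup>n+1\<^esup>\<close> (\<open>cauchy_kernel\<close>).  So the theorem says that an integral against \<open>F\<close>
  equals an integral against \<open>g\<close>, and it rests on one explicit computation,
  \<open>\<integral> E\<^sub>y\<^sub>,\<^sub>z = (2\<pi>)\<^sup>n (P + Q)(y, z)\<close> (\<open>monogenic_exponential_fourier\<close>).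

  The scalar part of this identity is the Fourier transform of \<open>e\<^bsup>-y|\<xi>|\<^esup>\<close> (\<open>poisson_fourier\<close>).
  Subordination writes \<open>e\<^bsup>-y|\<xi>|\<^esup>\<close> as an average of Gaussians, whose transforms are known, and
  the remaining one-dimensional integral is a Gamma integral.  The vector part is the transform of
  \<open>\<xi>\<^sub>j/|\<xi>| e\<^bsup>-y|\<xi>|\<^esup>\<close> (\<open>riesz_poisson_fourier\<close>); since this is \<open>-1/y\<close> times the \<open>j\<close>-th partial
  derivative of \<open>e\<^bsup>-y|\<xi>|\<^esup>\<close>, its transform is \<open>i z\<^sub>j/y\<close> times the one already known.

  If \<open>f\<close> is replaced by an integrable \<open>u\<close>, the transform is an honest integral, and Fubini's theorem
  moves it onto the kernel: the Fourier phase shifts \<open>z\<close> to \<open>(x - t)/b\<close>, and the computation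
  above produces the Cauchy kernel at \<open>x - t\<close> (\<open>monogenic_exponential_fubini\<close>).  The powers of
  \<open>b\<close> and \<open>2\<pi>\<close> cancel because the two square roots multiply to \<open>2\<pi>b\<close>.

  A general \<open>f\<close> is an \<open>L\<^sup>2\<close>-limit of such \<open>u\<close>, along which the transforms converge to \<open>F\<close> in
  \<open>L\<^sup>2\<close>.  Both \<open>E\<^sub>y\<^sub>,\<^sub>z\<close> and the Cauchy kernel are square integrable, so both sides are continuous
  under these limits by the Cauchy-Schwarz inequality
  (\<open>tendsto_integral_bilinear_square_integrable\<close>), and the identity for the functions \<open>u\<close> passes to \<open>f\<close>.
\<close>

section \<open>One-dimensional integrals: subordination and Gamma\<close>

text \<open>
  The error function without its factor \<open>2/\<surd>\<pi>\<close>.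
\<close>

definition gauss_primitive :: "real \<Rightarrow> real" where
  "gauss_primitive x = (LBINT t=0..x. exp (- t\<^sup>2))"

lemma DERIV_gauss_primitive: "(gauss_primitive has_real_derivative exp (- x\<^sup>2)) (at x)"
proof -
  define m where "m = \<bar>x\<bar> + 1"
  have "((\<lambda>u. LBINT y=0..u. exp (- y\<^sup>2)) has_vector_derivative exp (- x\<^sup>2)) (at x within {-m..m})"
    unfolding zero_ereal_def
    by (rule interval_integral_FTC2) (auto simp: m_def intro!: continuous_intros)
  moreover have "at x within {-m..m} = at x"
    by (rule at_within_interior) (auto simp: m_def)
  ultimately show ?thesis
    by (simp add: gauss_primitive_def[abs_def] has_real_derivative_iff_has_vector_derivative)
qed

lemma gauss_primitive_minus: "gauss_primitive (- x) = - gauss_primitive x"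
proof -
  have "((\<lambda>x. gauss_primitive x + gauss_primitive (- x)) has_real_derivative 0) (at t)" for t
    by (auto intro!: derivative_eq_intros DERIV_chain2[OF DERIV_gauss_primitive])
  then have "gauss_primitive x + gauss_primitive (- x) = gauss_primitive 0 + gauss_primitive (- 0)"
    by (intro DERIV_isconst_all[rule_format]) auto
  moreover have "gauss_primitive 0 = 0"
    by (simp add: gauss_primitive_def zero_ereal_def)
  ultimately show ?thesis by simp
qed

lemma gauss_primitive_at_top: "(gauss_primitive \<longlongrightarrow> sqrt pi / 2) at_top"
proof -
  have "((\<lambda>y. LINT x:{..y}|lborel. indicator {0..} x *\<^sub>R exp (- (x::real)\<^sup>2)) \<longlongrightarrow>
          (LINT x|lborel. indicator {0..} x *\<^sub>R exp (- (x::real)\<^sup>2))) at_top"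
    unfolding set_lebesgue_integral_def
    using tendsto_integral_at_top[OF sets_lborel integrable.intros[OF gaussian_moment_0]] by simp
  moreover have "(LINT x|lborel. indicator {0..} x *\<^sub>R exp (- (x::real)\<^sup>2)) = sqrt pi / 2"
    using gaussian_moment_0 by (rule has_bochner_integral_integral_eq)
  moreover have "\<forall>\<^sub>F y in at_top. (LINT x:{..y}|lborel. indicator {0..} x *\<^sub>R exp (- (x::real)\<^sup>2)) = gauss_primitive y"
    using eventually_ge_at_top[of 0]
  proof eventually_elim
    case (elim y)
    then have "gauss_primitive y = (LINT x:{0..y}|lborel. exp (- x\<^sup>2))"
      by (simp add: gauss_primitive_def interval_integral_Icc zero_ereal_def)
    then show ?case
      by (auto simp: set_lebesgue_integral_def indicator_def intro!: Bochner_Integration.integral_cong)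
  qed
  ultimately show ?thesis
    by (simp only: tendsto_cong)
qed

lemma gauss_primitive_at_bot: "(gauss_primitive \<longlongrightarrow> - sqrt pi / 2) at_bot"
proof -
  have "((\<lambda>x. - gauss_primitive (- x)) \<longlongrightarrow> - (sqrt pi / 2)) at_bot"
    by (intro tendsto_minus filterlim_compose[OF gauss_primitive_at_top] filterlim_uminus_at_top_at_bot)
  then show ?thesis by (simp add: gauss_primitive_minus)
qed

text \<open>
  The density of the Gamma distribution with shape \<open>1/2\<close> and scale \<open>1\<close>; it is the weight with
  which Gaussians are mixed below.
\<close>

definition gamma_half_density :: "real \<Rightarrow> real" where
  "gamma_half_density s = indicator {0<..} s * (exp (- s) / sqrt (pi * s))"

lemma borel_measurable_gamma_half_density [measurable]: "gamma_half_density \<in> borel_measurable borel"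
  unfolding gamma_half_density_def by measurable

lemma gamma_half_density_nonneg [simp]: "0 \<le> gamma_half_density s"
  by (auto simp: gamma_half_density_def indicator_def)

text \<open>
  The integrand has an elementary primitive up to the error function: completing the square in
  the exponent \<open>s + r\<^sup>2/(4s)\<close> as \<open>(\<surd>s - r/(2\<surd>s))\<^sup>2 + r\<close> and as \<open>(\<surd>s + r/(2\<surd>s))\<^sup>2 - r\<close> suggests the
  two terms of \<open>F\<close>, and the parts of their derivatives that contain \<open>s\<^bsup>-3/2\<^esup>\<close> cancel.
\<close>

lemma has_bochner_integral_subordination:
  fixes r :: real
  assumes "r > 0"
  shows "has_bochner_integral lborel (\<lambda>s. gamma_half_density s * exp (- r\<^sup>2 / (4 * s))) (exp (- r))"
proof -
  define f where "f s = exp (- s) / sqrt (pi * s) * exp (- r\<^sup>2 / (4 * s))" for s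
  define F where "F s = (exp (- r) * gauss_primitive (sqrt s - r / (2 * sqrt s)) +
      exp r * gauss_primitive (sqrt s + r / (2 * sqrt s))) / sqrt pi" for s
  have D: "(F has_real_derivative f s) (at s)" if "s > 0" for s
  proof -
    have s2: "(sqrt s)\<^sup>2 = s" using that by simp
    have e1: "exp (- r) * exp (- (sqrt s - r / (2 * sqrt s))\<^sup>2) = exp (- s) * exp (- r\<^sup>2 / (4 * s))"
      using that by (simp add: power2_diff power_divide power_mult_distrib flip: exp_add)
    have e2: "exp r * exp (- (sqrt s + r / (2 * sqrt s))\<^sup>2) = exp (- s) * exp (- r\<^sup>2 / (4 * s))"
      using that by (simp add: power2_sum power_divide power_mult_distrib flip: exp_add)
    have "((\<lambda>s. sqrt s - r / (2 * sqrt s)) has_real_derivative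
        (inverse (sqrt s) / 2 - r * - (2 * (inverse (sqrt s) / 2)) / (2 * sqrt s)\<^sup>2)) (at s)"
      using that by (auto intro!: derivative_eq_intros simp: power2_eq_square)
    also have "inverse (sqrt s) / 2 - r * - (2 * (inverse (sqrt s) / 2)) / (2 * sqrt s)\<^sup>2 = 1 / (2 * sqrt s) + r / (4 * s * sqrt s)"
      using that by (simp add: power_mult_distrib s2) (simp add: field_simps)
    finally have d1: "((\<lambda>s. sqrt s - r / (2 * sqrt s)) has_real_derivative
        (1 / (2 * sqrt s) + r / (4 * s * sqrt s))) (at s)" .
    have "((\<lambda>s. sqrt s + r / (2 * sqrt s)) has_real_derivative
        (inverse (sqrt s) / 2 + r * - (2 * (inverse (sqrt s) / 2)) / (2 * sqrt s)\<^sup>2)) (at s)"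
      using that by (auto intro!: derivative_eq_intros simp: power2_eq_square)
    also have "inverse (sqrt s) / 2 + r * - (2 * (inverse (sqrt s) / 2)) / (2 * sqrt s)\<^sup>2 = 1 / (2 * sqrt s) - r / (4 * s * sqrt s)"
      using that by (simp add: power_mult_distrib s2) (simp add: field_simps)
    finally have d2: "((\<lambda>s. sqrt s + r / (2 * sqrt s)) has_real_derivative
        (1 / (2 * sqrt s) - r / (4 * s * sqrt s))) (at s)" .
    have "(F has_real_derivative
        (exp (- r) * (exp (- (sqrt s - r / (2 * sqrt s))\<^sup>2) * (1 / (2 * sqrt s) + r / (4 * s * sqrt s))) +
         exp r * (exp (- (sqrt s + r / (2 * sqrt s))\<^sup>2) * (1 / (2 * sqrt s) - r / (4 * s * sqrt s)))) / sqrt pi) (at s)"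
      unfolding F_def
      by (intro DERIV_cdivide DERIV_add DERIV_cmult DERIV_chain2[OF DERIV_gauss_primitive d1]
            DERIV_chain2[OF DERIV_gauss_primitive d2])
    also have "(exp (- r) * (exp (- (sqrt s - r / (2 * sqrt s))\<^sup>2) * (1 / (2 * sqrt s) + r / (4 * s * sqrt s))) +
         exp r * (exp (- (sqrt s + r / (2 * sqrt s))\<^sup>2) * (1 / (2 * sqrt s) - r / (4 * s * sqrt s)))) / sqrt pi
        = f s"
      unfolding mult.assoc[symmetric] e1 e2 f_def using that
      by (simp add: field_simps real_sqrt_mult)
    finally show ?thesis by simp
  qed
  have C: "isCont f s" if "s > 0" for s
    unfolding f_def using that by (intro continuous_intros) auto
  have A: "((F \<circ> real_of_ereal) \<longlongrightarrow>
      (exp (- r) * (- sqrt pi / 2) + exp r * (sqrt pi / 2)) / sqrt pi) (at_right 0)"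
    unfolding zero_ereal_def ereal_tendsto_simps F_def
  proof (intro tendsto_intros)
    show "((\<lambda>s. gauss_primitive (sqrt s - r / (2 * sqrt s))) \<longlongrightarrow> - sqrt pi / 2) (at_right 0)"
      using assms by (intro filterlim_compose[OF gauss_primitive_at_bot]) real_asymp
    show "((\<lambda>s. gauss_primitive (sqrt s + r / (2 * sqrt s))) \<longlongrightarrow> sqrt pi / 2) (at_right 0)"
      using assms by (intro filterlim_compose[OF gauss_primitive_at_top]) real_asymp
  qed auto
  have B: "((F \<circ> real_of_ereal) \<longlongrightarrow>
      (exp (- r) * (sqrt pi / 2) + exp r * (sqrt pi / 2)) / sqrt pi) (at_left \<infinity>)"
    unfolding ereal_tendsto_simps F_def
  proof (intro tendsto_intros)
    show "((\<lambda>s. gauss_primitive (sqrt s - r / (2 * sqrt s))) \<longlongrightarrow> sqrt pi / 2) at_top"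
      using assms by (intro filterlim_compose[OF gauss_primitive_at_top]) real_asymp
    show "((\<lambda>s. gauss_primitive (sqrt s + r / (2 * sqrt s))) \<longlongrightarrow> sqrt pi / 2) at_top"
      using assms by (intro filterlim_compose[OF gauss_primitive_at_top]) real_asymp
  qed auto
  have nn: "AE s in lborel. 0 < ereal s \<longrightarrow> ereal s < \<infinity> \<longrightarrow> 0 \<le> f s"
    by (auto simp: f_def)
  note FTC = interval_integral_FTC_nonneg[of 0 \<infinity> F f, OF _ _ _ nn A B]
  have I: "set_integrable lborel (einterval 0 \<infinity>) f"
    by (rule FTC(1)) (use D C in auto)
  have "(LBINT s=0..\<infinity>. f s) = exp (- r)"
    by (subst FTC(2)) (use D C in \<open>auto simp: add_divide_distrib diff_divide_distrib\<close>)
  then have J: "(LINT s|lborel. indicator (einterval 0 \<infinity>) s *\<^sub>R f s) = exp (- r)"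
    by (simp add: interval_lebesgue_integral_def set_lebesgue_integral_def)
  have eq: "(\<lambda>s. indicator (einterval 0 \<infinity>) s *\<^sub>R f s) = (\<lambda>s. gamma_half_density s * exp (- r\<^sup>2 / (4 * s)))"
    by (auto simp: fun_eq_iff f_def gamma_half_density_def indicator_def einterval_def)
  show ?thesis
    using I J unfolding has_bochner_integral_iff set_integrable_def eq by blast
qed

lemma has_bochner_integral_Gamma_scaled:
  fixes p l :: real
  assumes "p > 0" "l > 0"
  shows "has_bochner_integral lborel (\<lambda>s. indicator {0<..} s * (s powr (p - 1) * exp (- l * s)))
     (Gamma p / l powr p)"
proof -
  define f where "f s = indicator {0<..} s * (s powr (p - 1) * exp (- s))" for s :: real
  have "(\<integral>\<^sup>+s. ennreal (s powr (p - 1) / exp s) * indicator {0..} s \<partial>lborel) = ennreal (Gamma p)"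
    by (rule nn_integral_has_integral_lebesgue') (auto intro: Gamma_integral_real assms)
  also have "(\<integral>\<^sup>+s. ennreal (s powr (p - 1) / exp s) * indicator {0..} s \<partial>lborel) = (\<integral>\<^sup>+s. ennreal (f s) \<partial>lborel)"
    by (intro nn_integral_cong) (auto simp: f_def exp_minus field_simps indicator_def)
  finally have "has_bochner_integral lborel f (Gamma p)"
    using assms by (intro has_bochner_integral_nn_integral) (auto simp: f_def[abs_def] Gamma_real_nonneg)
  then have "has_bochner_integral lborel (\<lambda>s. f (0 + l * s)) (Gamma p /\<^sub>R \<bar>l\<bar>)"
    using assms by (subst (asm) lborel_has_bochner_integral_real_affine_iff[where c = l and t = 0]) auto
  then have "has_bochner_integral lborel (\<lambda>s. l powr (1 - p) * f (l * s)) (l powr (1 - p) * (Gamma p / l))"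
    using assms by (intro has_bochner_integral_mult_right) (auto simp: field_simps)
  moreover have "l powr (1 - p) * f (l * s) = indicator {0<..} s * (s powr (p - 1) * exp (- l * s))" for s
  proof (cases "s > 0")
    case True
    then have "l powr (1 - p) * (l * s) powr (p - 1) = s powr (p - 1) * (l powr (1 - p) * l powr (p - 1))"
      using assms by (simp add: powr_mult)
    also have "l powr (1 - p) * l powr (p - 1) = 1"
      using assms by (simp flip: powr_add)
    finally show ?thesis
      using True assms by (simp add: f_def flip: mult.assoc)
  next
    case False
    then show ?thesis using assms by (auto simp: f_def zero_less_mult_iff)
  qed
  moreover have "l powr (1 - p) * (Gamma p / l) = Gamma p / l powr p"
    using assms by (simp add: powr_diff divide_simps)
  ultimately show ?thesis by simp
qed

section \<open>The Fourier transform of a Gaussian\<close>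

lemma gaussian_fourier_real:
  fixes \<alpha> z :: real
  assumes "\<alpha> > 0"
  shows "has_bochner_integral lborel (\<lambda>x. complex_of_real (exp (- \<alpha> * x\<^sup>2)) * cis (z * x))
    (complex_of_real (sqrt (pi / \<alpha>) * exp (- z\<^sup>2 / (4 * \<alpha>))))"
proof -
  define c where "c = sqrt (2 * \<alpha>)"
  have c: "c > 0" "c\<^sup>2 = 2 * \<alpha>" using assms by (auto simp: c_def)
  define f where "f x = std_normal_density x *\<^sub>R iexp (z / c * x)" for x
  have I: "integrable lborel f"
    unfolding f_def
    by (rule Bochner_Integration.integrable_bound[OF integrable_normal_density[of 1 0]])
       (auto intro!: AE_I2)
  have "integral\<^sup>L lborel f = char std_normal_distribution (z / c)"
    unfolding f_def char_def by (subst integral_density) (auto simp: mult.commute)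
  then have "has_bochner_integral lborel f (complex_of_real (exp (- ((z / c)\<^sup>2) / 2)))"
    using I by (simp add: has_bochner_integral_iff char_std_normal_distribution)
  then have "has_bochner_integral lborel (\<lambda>x. f (0 + c * x)) (complex_of_real (exp (- ((z / c)\<^sup>2) / 2)) /\<^sub>R \<bar>c\<bar>)"
    using c by (subst (asm) lborel_has_bochner_integral_real_affine_iff[where c = c and t = 0]) auto
  then have "has_bochner_integral lborel (\<lambda>x. sqrt (2 * pi) *\<^sub>R f (0 + c * x))
      (sqrt (2 * pi) *\<^sub>R (complex_of_real (exp (- ((z / c)\<^sup>2) / 2)) /\<^sub>R \<bar>c\<bar>))"
    by (intro has_bochner_integral_scaleR_right) auto
  moreover have "sqrt (2 * pi) *\<^sub>R f (0 + c * x) = complex_of_real (exp (- \<alpha> * x\<^sup>2)) * cis (z * x)" for x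
    using c by (simp add: f_def std_normal_density_def power_mult_distrib scaleR_conv_of_real
        cis_conv_exp)
  moreover have "sqrt (2 * pi) *\<^sub>R (complex_of_real (exp (- ((z / c)\<^sup>2) / 2)) /\<^sub>R \<bar>c\<bar>)
     = complex_of_real (sqrt (pi / \<alpha>) * exp (- z\<^sup>2 / (4 * \<alpha>)))"
  proof -
    have "sqrt (pi / \<alpha>) = sqrt (2 * pi) / c"
      unfolding c_def real_sqrt_divide[symmetric] by simp
    moreover have "- z\<^sup>2 / (4 * \<alpha>) = - ((z / c)\<^sup>2) / 2"
      by (simp add: power_divide c)
    ultimately have "sqrt (pi / \<alpha>) * exp (- z\<^sup>2 / (4 * \<alpha>)) = sqrt (2 * pi) * (exp (- ((z / c)\<^sup>2) / 2) / \<bar>c\<bar>)"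
      using c(1) by simp
    then show ?thesis
      by (simp only: scaleR_conv_of_real of_real_mult of_real_divide of_real_inverse divide_inverse mult.commute)
  qed
  ultimately show ?thesis by simp
qed

lemma borel_measurable_cis [measurable]: "cis \<in> borel_measurable borel"
  by (intro borel_measurable_continuous_onI continuous_intros)

text \<open>
  Lebesgue measure on a Euclidean space is the product of the Lebesgue measures of its coordinate
  axes, so integrals of products of functions of one coordinate each factor.
\<close>

lemma has_bochner_integral_lborel_prod:
  fixes f :: "'a::euclidean_space \<Rightarrow> real \<Rightarrow> 'b::{real_normed_field,banach,second_countable_topology}"
  assumes "\<And>b. b \<in> Basis \<Longrightarrow> has_bochner_integral lborel (f b) (I b)"
  shows "has_bochner_integral lborel (\<lambda>x::'a. \<Prod>b\<in>Basis. f b (x \<bullet> b)) (\<Prod>b\<in>Basis. I b)"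
proof -
  interpret product_sigma_finite "\<lambda>_::'a. lborel :: real measure"
    by standard
  have f: "integrable lborel (f b)" "integral\<^sup>L lborel (f b) = I b" if "b \<in> Basis" for b
    using assms[OF that] by (auto simp: has_bochner_integral_iff)
  have [measurable]: "f b \<in> borel_measurable borel" if "b \<in> Basis" for b
    using borel_measurable_integrable[OF f(1)[OF that]] by simp
  have [measurable]: "(\<lambda>x::'a. \<Prod>b\<in>Basis. f b (x \<bullet> b)) \<in> borel_measurable borel"
    by (intro borel_measurable_prod measurable_compose[OF _ \<open>\<And>b. b \<in> Basis \<Longrightarrow> f b \<in> borel_measurable borel\<close>]) auto
  have eq: "(\<Prod>b\<in>Basis. f b ((\<Sum>b\<in>Basis. x b *\<^sub>R b) \<bullet> b)) = (\<Prod>b\<in>Basis. f b (x b))" for x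
    by (intro prod.cong refl) simp
  show ?thesis
    unfolding has_bochner_integral_iff lborel_eq[where 'a = 'a]
    using product_integrable_prod[of Basis f] product_integral_prod[of Basis f] f
    by (simp add: integrable_distr_eq integral_distr eq cong: prod.cong)
qed

lemma gaussian_fourier:
  fixes z :: "'a::euclidean_space"
  assumes "\<alpha> > 0"
  shows "has_bochner_integral lborel (\<lambda>\<xi>::'a. complex_of_real (exp (- \<alpha> * (norm \<xi>)\<^sup>2)) * cis (z \<bullet> \<xi>))
    (complex_of_real ((pi / \<alpha>) powr (DIM('a) / 2) * exp (- (norm z)\<^sup>2 / (4 * \<alpha>))))"
proof -
  have "has_bochner_integral lborel
      (\<lambda>\<xi>::'a. \<Prod>b\<in>Basis. complex_of_real (exp (- \<alpha> * (\<xi> \<bullet> b)\<^sup>2)) * cis ((z \<bullet> b) * (\<xi> \<bullet> b)))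
      (\<Prod>b\<in>(Basis::'a set). complex_of_real (sqrt (pi / \<alpha>) * exp (- (z \<bullet> b)\<^sup>2 / (4 * \<alpha>))))"
    by (intro has_bochner_integral_lborel_prod gaussian_fourier_real assms)
  moreover have "(\<Prod>b\<in>Basis. complex_of_real (exp (- \<alpha> * (\<xi> \<bullet> b)\<^sup>2)) * cis ((z \<bullet> b) * (\<xi> \<bullet> b)))
      = complex_of_real (exp (- \<alpha> * (norm \<xi>)\<^sup>2)) * cis (z \<bullet> \<xi>)" for \<xi> :: 'a
  proof -
    have "(norm \<xi>)\<^sup>2 = (\<Sum>b\<in>Basis. (\<xi> \<bullet> b)\<^sup>2)"
      by (subst power2_norm_eq_inner, subst euclidean_inner) (simp add: power2_eq_square)
    then have "(\<Prod>b\<in>Basis. exp (- \<alpha> * (\<xi> \<bullet> b)\<^sup>2)) = exp (- \<alpha> * (norm \<xi>)\<^sup>2)"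
      by (simp add: sum_distrib_left flip: exp_sum)
    moreover have "(\<Prod>b\<in>Basis. cis ((z \<bullet> b) * (\<xi> \<bullet> b))) = cis (z \<bullet> \<xi>)"
    proof -
      have "(\<Prod>b\<in>B. cis (h b)) = cis (\<Sum>b\<in>B. h b)" if "finite B" for B :: "'a set" and h
        using that by induction (auto simp: cis_mult)
      then show ?thesis
        by (subst euclidean_inner) auto
    qed
    ultimately show ?thesis
      by (simp add: prod.distrib flip: of_real_prod)
  qed
  moreover have "(\<Prod>b\<in>(Basis::'a set). complex_of_real (sqrt (pi / \<alpha>) * exp (- (z \<bullet> b)\<^sup>2 / (4 * \<alpha>))))
     = complex_of_real ((pi / \<alpha>) powr (DIM('a) / 2) * exp (- (norm z)\<^sup>2 / (4 * \<alpha>)))"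
  proof -
    have "(norm z)\<^sup>2 = (\<Sum>b\<in>Basis. (z \<bullet> b)\<^sup>2)"
      by (subst power2_norm_eq_inner, subst euclidean_inner) (simp add: power2_eq_square)
    moreover have "sqrt (pi / \<alpha>) ^ DIM('a) = (pi / \<alpha>) powr (DIM('a) / 2)"
      using assms by (simp add: powr_half_sqrt[symmetric] powr_powr flip: powr_realpow)
    ultimately have "(\<Prod>b\<in>(Basis::'a set). sqrt (pi / \<alpha>) * exp (- (z \<bullet> b)\<^sup>2 / (4 * \<alpha>))) =
        (pi / \<alpha>) powr (DIM('a) / 2) * exp (- (norm z)\<^sup>2 / (4 * \<alpha>))"
      by (simp add: prod.distrib sum_negf sum_divide_distrib flip: exp_sum)
    then show ?thesis
      by (simp only: of_real_prod[symmetric])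
  qed
  ultimately show ?thesis by simp
qed

section \<open>The Fourier transforms of the Poisson weight and of its gradient\<close>

text \<open>
  The normalising constant of the Poisson kernel of \<open>\<real>\<^sup>n\<close>.
\<close>

definition poisson_constant :: "nat \<Rightarrow> real" where
  "poisson_constant n = Gamma ((real n + 1) / 2) / pi powr ((real n + 1) / 2)"

text \<open>
  The second factor is the Fourier transform at a point \<open>z\<close> with \<open>|z|\<^sup>2 = q\<close> of the Gaussian
  \<open>exp (-y\<^sup>2|\<xi>|\<^sup>2/(4s))\<close> on \<open>\<real>\<^sup>n\<close>.  Averaging it over \<open>s\<close> gives a Gamma integral with exponent
  \<open>(n+1)/2\<close> and rate \<open>1 + q/y\<^sup>2\<close>, which is where the Poisson kernel appears.
\<close>

lemma has_bochner_integral_poisson_profile: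
  fixes q y :: real
  assumes "y > 0" "q \<ge> 0"
  shows "has_bochner_integral lborel
    (\<lambda>s. gamma_half_density s * ((4 * pi * s / y\<^sup>2) powr (n / 2) * exp (- q * s / y\<^sup>2)))
    ((2 * pi) ^ n * (poisson_constant n * (y / sqrt (y\<^sup>2 + q) ^ (n + 1))))"
proof -
  define p where "p = (real n + 1) / 2"
  define l where "l = 1 + q / y\<^sup>2"
  define C where "C = (4 * pi / y\<^sup>2) powr (n / 2) / sqrt pi"
  have p: "p > 0" and l: "l > 0" using assms by (auto simp: p_def l_def add_pos_nonneg)
  have "has_bochner_integral lborel
      (\<lambda>s. C * (indicator {0<..} s * (s powr (p - 1) * exp (- l * s)))) (C * (Gamma p / l powr p))"
    by (intro has_bochner_integral_mult_right has_bochner_integral_Gamma_scaled p l)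
  moreover have "C * (indicator {0<..} s * (s powr (p - 1) * exp (- l * s))) =
      gamma_half_density s * ((4 * pi * s / y\<^sup>2) powr (n / 2) * exp (- q * s / y\<^sup>2))" for s
  proof (cases "s > 0")
    case True
    have "(4 * pi * s / y\<^sup>2) powr (n / 2) = (4 * pi / y\<^sup>2) powr (n / 2) * s powr (n / 2)"
      using True by (subst powr_mult[symmetric]) (auto simp: field_simps)
    moreover have "s powr (n / 2) = s powr (p - 1) * sqrt s"
      using True by (simp add: p_def powr_half_sqrt[symmetric] field_simps flip: powr_add)
    moreover have "exp (- l * s) = exp (- s) * exp (- q * s / y\<^sup>2)"
      by (simp add: l_def algebra_simps flip: exp_add)
    ultimately show ?thesis using True
      by (simp add: gamma_half_density_def C_def real_sqrt_mult)
  qed (simp add: gamma_half_density_def)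
  moreover have "C * (Gamma p / l powr p) =
      (2 * pi) ^ n * (poisson_constant n * (y / sqrt (y\<^sup>2 + q) ^ (n + 1)))"
  proof -
    define R where "R = y\<^sup>2 + q"
    have R: "R > 0" "l = R / y\<^sup>2" using assms by (auto simp: R_def l_def field_simps intro!: add_pos_nonneg add_nonneg_pos)
    have sq: "x powr (k / 2) = sqrt x ^ k" if "x > 0" for x :: real and k :: nat
      using that by (simp add: powr_half_sqrt[symmetric] powr_powr flip: powr_realpow)
    have A: "l powr p = (sqrt R / y) ^ (n + 1)"
      using R assms sq[of l "n + 1"] l by (simp add: p_def real_sqrt_divide add.commute)
    have B: "(4 * pi / y\<^sup>2) powr (n / 2) = (2 * sqrt pi / y) ^ n"
      using assms by (simp add: sq real_sqrt_divide real_sqrt_mult)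
    have D: "pi powr p = sqrt pi ^ (n + 1)"
      using sq[of pi "n + 1"] by (simp add: p_def add.commute)
    have E: "(2 * pi) ^ n = 2 ^ n * (sqrt pi ^ n * sqrt pi ^ n)"
      by (simp add: power_mult_distrib flip: power_mult_distrib[of "sqrt pi"])
    show ?thesis
      unfolding poisson_constant_def p_def[symmetric] R_def[symmetric] C_def A B D E
      using R assms by (simp add: power_divide power_mult_distrib)
  qed
  ultimately show ?thesis by simp
qed

text \<open>
  Subordination with \<open>r = y|\<xi>|\<close> exhibits \<open>e\<^bsup>-y|\<xi>|\<^esup>\<close> as a mixture of Gaussians in \<open>\<xi>\<close>, and the
  transform may be taken under the integral over \<open>s\<close>.  The same exchange of integrals, applied to
  absolute values (the case \<open>z = 0\<close>), supplies the integrability of \<open>e\<^bsup>-y|\<xi>|\<^esup>\<close>.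
\<close>

lemma poisson_fourier:
  fixes z :: "'a::euclidean_space"
  assumes "y > 0"
  shows "has_bochner_integral lborel (\<lambda>\<xi>::'a. complex_of_real (exp (- y * norm \<xi>)) * cis (z \<bullet> \<xi>))
    (complex_of_real ((2 * pi) ^ DIM('a) *
      (poisson_constant DIM('a) * (y / sqrt (y\<^sup>2 + (norm z)\<^sup>2) ^ (DIM('a) + 1)))))"
proof -
  define \<Phi> :: "real \<times> 'a \<Rightarrow> complex" where
    "\<Phi> = (\<lambda>(s, \<xi>). gamma_half_density s *\<^sub>R (complex_of_real (exp (- (y\<^sup>2 / (4 * s)) * (norm \<xi>)\<^sup>2)) * cis (z \<bullet> \<xi>)))"
  have M: "\<Phi> \<in> borel_measurable (lborel \<Otimes>\<^sub>M lborel)"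
    unfolding \<Phi>_def by measurable
  have inner: "has_bochner_integral lborel (\<lambda>\<xi>. \<Phi> (s, \<xi>))
      (complex_of_real (gamma_half_density s * ((4 * pi * s / y\<^sup>2) powr (DIM('a) / 2) * exp (- (norm z)\<^sup>2 * s / y\<^sup>2))))" for s
  proof (cases "s > 0")
    case True
    show ?thesis
      using has_bochner_integral_scaleR_right[OF gaussian_fourier[of "y\<^sup>2 / (4 * s)" z], of "gamma_half_density s"] True assms
      by (simp add: \<Phi>_def scaleR_conv_of_real field_simps)
  qed (simp add: \<Phi>_def gamma_half_density_def has_bochner_integral_zero)
  have norm_\<Phi>: "norm (\<Phi> (s, \<xi>)) = gamma_half_density s * exp (- (y\<^sup>2 / (4 * s)) * (norm \<xi>)\<^sup>2)" for s \<xi>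
    by (simp add: \<Phi>_def norm_mult)
  have inner_norm: "(\<integral>\<xi>. norm (\<Phi> (s, \<xi>)) \<partial>lborel) =
      gamma_half_density s * ((4 * pi * s / y\<^sup>2) powr (DIM('a) / 2) * exp (- 0 * s / y\<^sup>2))" for s
  proof (cases "s > 0")
    case True
    have "has_bochner_integral lborel (\<lambda>\<xi>::'a. Re (complex_of_real (exp (- (y\<^sup>2 / (4 * s)) * (norm \<xi>)\<^sup>2)) * cis (0 \<bullet> \<xi>)))
       (Re (complex_of_real ((pi / (y\<^sup>2 / (4 * s))) powr (DIM('a) / 2) * exp (- (norm (0::'a))\<^sup>2 / (4 * (y\<^sup>2 / (4 * s)))))))"
      using True assms by (intro has_bochner_integral_bounded_linear[OF bounded_linear_Re] gaussian_fourier) auto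
    then have "has_bochner_integral lborel (\<lambda>\<xi>::'a. exp (- (y\<^sup>2 / (4 * s)) * (norm \<xi>)\<^sup>2))
       ((4 * pi * s / y\<^sup>2) powr (DIM('a) / 2))"
      by (simp add: mult.commute mult.left_commute)
    then show ?thesis
      unfolding norm_\<Phi> by (simp add: has_bochner_integral_iff)
  qed (simp add: norm_\<Phi> gamma_half_density_def)
  have int: "integrable (lborel \<Otimes>\<^sub>M lborel) \<Phi>"
  proof (rule lborel_pair.Fubini_integrable[OF M])
    show "integrable lborel (\<lambda>s. \<integral>\<xi>. norm (\<Phi> (s, \<xi>)) \<partial>lborel)"
      unfolding inner_norm using has_bochner_integral_poisson_profile[of y 0 "DIM('a)"] assms
      by (auto intro: integrable.intros)
    show "AE s in lborel. integrable lborel (\<lambda>\<xi>. \<Phi> (s, \<xi>))"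
      using inner by (auto intro: integrable.intros)
  qed
  have outer: "(\<integral>s. \<Phi> (s, \<xi>) \<partial>lborel) = complex_of_real (exp (- y * norm \<xi>)) * cis (z \<bullet> \<xi>)" if "\<xi> \<noteq> 0" for \<xi>
  proof -
    have "has_bochner_integral lborel (\<lambda>s. (gamma_half_density s * exp (- (y * norm \<xi>)\<^sup>2 / (4 * s))) *\<^sub>R cis (z \<bullet> \<xi>))
      (exp (- (y * norm \<xi>)) *\<^sub>R cis (z \<bullet> \<xi>))"
      using that assms by (intro has_bochner_integral_scaleR_left has_bochner_integral_subordination) auto
    then show ?thesis
      by (simp add: has_bochner_integral_iff \<Phi>_def scaleR_conv_of_real power_mult_distrib mult.assoc)
  qed
  \<comment> \<open>The subordination formula is available only for \<open>r > 0\<close>, so \<open>\<xi> = 0\<close> is left out as a null set.\<close>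
  have ae: "AE \<xi> in lborel. (\<integral>s. \<Phi> (s, \<xi>) \<partial>lborel) = complex_of_real (exp (- y * norm \<xi>)) * cis (z \<bullet> \<xi>)"
    using AE_lborel_singleton[of "0::'a"] by eventually_elim (rule outer)
  have "integrable lborel (\<lambda>\<xi>. \<integral>s. \<Phi> (s, \<xi>) \<partial>lborel)"
    using int by (intro lborel_pair.integrable_snd) (simp add: case_prod_unfold)
  then have I: "integrable lborel (\<lambda>\<xi>::'a. complex_of_real (exp (- y * norm \<xi>)) * cis (z \<bullet> \<xi>))"
    by (rule integrable_cong_AE_imp) (use ae in \<open>auto elim: eventually_mono\<close>)
  have "(\<integral>\<xi>. complex_of_real (exp (- y * norm \<xi>)) * cis (z \<bullet> \<xi>) \<partial>lborel) = (\<integral>\<xi>. (\<integral>s. \<Phi> (s, \<xi>) \<partial>lborel) \<partial>lborel)"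
    using ae int by (intro integral_cong_AE) (auto elim: eventually_mono)
  also have "\<dots> = (\<integral>s. (\<integral>\<xi>. \<Phi> (s, \<xi>) \<partial>lborel) \<partial>lborel)"
    using int by (intro lborel_pair.Fubini_integral) (simp add: case_prod_unfold)
  also have "\<dots> = complex_of_real ((2 * pi) ^ DIM('a) *
      (poisson_constant DIM('a) * (y / sqrt (y\<^sup>2 + (norm z)\<^sup>2) ^ (DIM('a) + 1))))"
    using inner has_bochner_integral_poisson_profile[of y "(norm z)\<^sup>2" "DIM('a)"] assms
    by (simp only: has_bochner_integral_iff integral_complex_of_real) simp
  finally show ?thesis using I
    by (simp add: has_bochner_integral_iff)
qed

text \<open>
  The mean value estimate that dominates the difference quotients of \<open>e\<^bsup>-y|\<xi>|\<^esup>\<close> below.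
\<close>

lemma abs_exp_minus_diff_le:
  fixes a b :: real
  assumes "m \<le> a" "m \<le> b"
  shows "\<bar>exp (- a) - exp (- b)\<bar> \<le> \<bar>a - b\<bar> * exp (- m)"
proof -
  have *: "exp (- a) - exp (- b) \<le> (b - a) * exp (- m)" if "a \<le> b" "m \<le> a" for a b :: real
  proof -
    have "exp (- a) - exp (- b) = (1 - exp (- (b - a))) * exp (- a)"
      by (simp add: algebra_simps flip: exp_add)
    also have "\<dots> \<le> (b - a) * exp (- a)"
    proof (rule mult_right_mono)
      show "1 - exp (- (b - a)) \<le> b - a"
        using exp_ge_add_one_self[of "- (b - a)"] by linarith
    qed simp
    also have "\<dots> \<le> (b - a) * exp (- m)"
      using that by (intro mult_left_mono) auto
    finally show ?thesis .
  qed
  show ?thesis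
    using *[of a b] *[of b a] assms by (cases "a \<le> b") (auto simp: abs_if)
qed

lemma has_bochner_integral_lborel_translate:
  fixes f :: "'a::euclidean_space \<Rightarrow> 'b::{banach, second_countable_topology}"
  assumes "has_bochner_integral lborel f I"
  shows "has_bochner_integral lborel (\<lambda>x. f (a + x)) I"
proof -
  have [measurable]: "f \<in> borel_measurable borel"
    using assms by (auto dest: has_bochner_integral_integrable borel_measurable_integrable simp: has_bochner_integral_iff)
  have "has_bochner_integral (distr lborel borel ((+) a)) f I"
    using assms by (simp add: lborel_distr_plus)
  then show ?thesis
    by (simp add: has_bochner_integral_iff integrable_distr_eq integral_distr)
qed

text \<open>
  Away from \<open>0\<close>, the weight is \<open>-1/y\<close> times the derivative of \<open>\<phi>(\<xi>) = e\<^bsup>-y|\<xi>|\<^esup>\<close> in direction \<open>v\<close>, so this is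
  integration by parts against \<open>e\<^bsup>i\<langle>z,\<xi>\<rangle>\<^esup>\<close>.  It is carried out on difference quotients: translating
  \<open>\<phi>\<close> by \<open>hv\<close> multiplies its transform by \<open>e\<^bsup>-ih\<langle>z,v\<rangle>\<^esup>\<close>, and the quotients are dominated by a
  multiple of \<open>\<phi>\<close> uniformly in \<open>h \<le> 1\<close>.  This avoids boundary terms and the kink of \<open>\<phi>\<close> at \<open>0\<close>.
\<close>

lemma riesz_poisson_fourier:
  fixes z v :: "'a::euclidean_space"
  assumes "y > 0"
  defines "I \<equiv> complex_of_real ((2 * pi) ^ DIM('a) *
      (poisson_constant DIM('a) * (y / sqrt (y\<^sup>2 + (norm z)\<^sup>2) ^ (DIM('a) + 1))))"
  shows "has_bochner_integral lborel
    (\<lambda>\<xi>::'a. complex_of_real (exp (- y * norm \<xi>) * ((\<xi> \<bullet> v) / norm \<xi>)) * cis (z \<bullet> \<xi>))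
    (\<i> * complex_of_real ((z \<bullet> v) / y) * I)"
proof -
  define \<phi> :: "'a \<Rightarrow> real" where "\<phi> \<xi> = exp (- y * norm \<xi>)" for \<xi>
  define h where "h k = 1 / (real k + 1)" for k
  have h: "h k > 0" "h k \<le> 1" for k by (auto simp: h_def)
  have h0: "h \<longlonglongrightarrow> 0"
    unfolding h_def by real_asymp
  have h_nz: "h k \<noteq> 0" for k using h(1)[of k] by simp
  have h_at: "filterlim h (at 0) sequentially"
    unfolding filterlim_at using h0 h_nz by simp
  have [measurable]: "\<phi> \<in> borel_measurable borel" unfolding \<phi>_def by measurable
  have base: "has_bochner_integral lborel (\<lambda>\<xi>. complex_of_real (\<phi> \<xi>) * cis (z \<bullet> \<xi>)) I"
    unfolding \<phi>_def I_def by (rule poisson_fourier[OF assms(1)])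
  define D where "D k \<xi> = complex_of_real ((\<phi> (h k *\<^sub>R v + \<xi>) - \<phi> \<xi>) / h k) * cis (z \<bullet> \<xi>)" for k \<xi>
  define L where "L \<xi> = complex_of_real (- y * \<phi> \<xi> * ((\<xi> \<bullet> v) / norm \<xi>)) * cis (z \<bullet> \<xi>)" for \<xi>
  have D_int: "has_bochner_integral lborel (D k) ((cis (- h k * (z \<bullet> v)) - 1) / of_real (h k) * I)" for k
  proof -
    have "has_bochner_integral lborel (\<lambda>\<xi>. cis (- h k * (z \<bullet> v)) * (complex_of_real (\<phi> (h k *\<^sub>R v + \<xi>)) * cis (z \<bullet> (h k *\<^sub>R v + \<xi>))))
        (cis (- h k * (z \<bullet> v)) * I)"
      using has_bochner_integral_lborel_translate[OF base, of "h k *\<^sub>R v"] by (rule has_bochner_integral_mult_right)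
    moreover have "cis (- h k * (z \<bullet> v)) * (complex_of_real (\<phi> (h k *\<^sub>R v + \<xi>)) * cis (z \<bullet> (h k *\<^sub>R v + \<xi>)))
        = complex_of_real (\<phi> (h k *\<^sub>R v + \<xi>)) * cis (z \<bullet> \<xi>)" for \<xi>
      by (simp add: inner_add_right cis_mult mult.left_commute)
    ultimately have "has_bochner_integral lborel (\<lambda>\<xi>. complex_of_real (\<phi> (h k *\<^sub>R v + \<xi>)) * cis (z \<bullet> \<xi>))
        (cis (- h k * (z \<bullet> v)) * I)"
      by (simp only:)
    from has_bochner_integral_mult_right[OF has_bochner_integral_diff[OF this base], of "1 / of_real (h k)"]
    show ?thesis
      by (simp add: D_def[abs_def] algebra_simps diff_divide_distrib)
  qed
  have lim: "(\<lambda>k. D k \<xi>) \<longlonglongrightarrow> L \<xi>" if "\<xi> \<noteq> 0" for \<xi>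
  proof -
    have "((\<lambda>t. \<phi> (t *\<^sub>R v + \<xi>)) has_real_derivative - y * \<phi> \<xi> * ((\<xi> \<bullet> v) / norm \<xi>)) (at 0)"
    proof -
      have "((\<lambda>t. norm (t *\<^sub>R v + \<xi>)) has_derivative (\<lambda>t. (t *\<^sub>R v) \<bullet> sgn \<xi>)) (at 0)"
        by (rule has_derivative_norm[THEN has_derivative_compose[rotated], of "\<lambda>t. t *\<^sub>R v + \<xi>" 0, simplified])
           (use that in \<open>auto intro!: derivative_eq_intros\<close>)
      then have "((\<lambda>t. norm (t *\<^sub>R v + \<xi>)) has_real_derivative (\<xi> \<bullet> v) / norm \<xi>) (at 0)"
        by (rule has_derivative_imp_has_field_derivative)
           (simp add: sgn_div_norm inner_commute field_simps)
      then show ?thesis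
        unfolding \<phi>_def by (auto intro!: derivative_eq_intros)
    qed
    then have "((\<lambda>t. (\<phi> (t *\<^sub>R v + \<xi>) - \<phi> \<xi>) / t) \<longlongrightarrow> - y * \<phi> \<xi> * ((\<xi> \<bullet> v) / norm \<xi>)) (at 0)"
      by (simp add: DERIV_def)
    from filterlim_compose[OF this h_at] show ?thesis
      unfolding D_def L_def by (intro tendsto_intros)
  qed
  have bound: "norm (D k \<xi>) \<le> y * norm v * exp (y * norm v) * \<phi> \<xi>" for k \<xi>
  proof -
    have n: "norm (h k *\<^sub>R v) \<le> norm v"
      using h[of k] by (simp add: mult_left_le_one_le)
    have "\<bar>\<phi> (h k *\<^sub>R v + \<xi>) - \<phi> \<xi>\<bar> \<le> \<bar>y * norm (h k *\<^sub>R v + \<xi>) - y * norm \<xi>\<bar> * exp (- (y * (norm \<xi> - norm v)))"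
      unfolding \<phi>_def mult_minus_left
    proof (rule abs_exp_minus_diff_le)
      show "y * (norm \<xi> - norm v) \<le> y * norm (h k *\<^sub>R v + \<xi>)"
        using n norm_triangle_ineq2[of \<xi> "- (h k *\<^sub>R v)"] assms(1)
        by (intro mult_left_mono) (auto simp: add.commute)
      show "y * (norm \<xi> - norm v) \<le> y * norm \<xi>"
        using assms(1) by (intro mult_left_mono) auto
    qed
    also have "\<bar>y * norm (h k *\<^sub>R v + \<xi>) - y * norm \<xi>\<bar> = y * \<bar>norm (h k *\<^sub>R v + \<xi>) - norm \<xi>\<bar>"
      using assms(1) by (simp add: abs_mult flip: right_diff_distrib)
    also have "\<dots> \<le> y * (h k * norm v)"
      using norm_triangle_ineq3[of "h k *\<^sub>R v + \<xi>" \<xi>] assms(1) h[of k] by (intro mult_left_mono) auto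
    also have "exp (- (y * (norm \<xi> - norm v))) = exp (y * norm v) * \<phi> \<xi>"
      by (simp add: \<phi>_def algebra_simps flip: exp_add)
    finally have "\<bar>\<phi> (h k *\<^sub>R v + \<xi>) - \<phi> \<xi>\<bar> \<le> y * (h k * norm v) * (exp (y * norm v) * \<phi> \<xi>)"
      by simp
    moreover have "norm (D k \<xi>) = \<bar>\<phi> (h k *\<^sub>R v + \<xi>) - \<phi> \<xi>\<bar> / h k"
      unfolding D_def norm_mult norm_of_real using h[of k] by simp
    ultimately show ?thesis
      using h(1)[of k] by (simp add: pos_divide_le_eq mult_ac)
  qed
  have "integrable lborel \<phi>"
    using has_bochner_integral_bounded_linear[OF bounded_linear_Re poisson_fourier[OF assms(1), of "0::'a"]]
    by (auto simp: \<phi>_def[abs_def] has_bochner_integral_iff)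
  then have w: "integrable lborel (\<lambda>\<xi>. y * norm v * exp (y * norm v) * \<phi> \<xi>)"
    by simp
  have ae: "AE \<xi> in lborel. (\<lambda>k. D k \<xi>) \<longlonglongrightarrow> L \<xi>"
    using AE_lborel_singleton[of "0::'a"] by eventually_elim (rule lim)
  have [measurable]: "L \<in> borel_measurable borel" "D k \<in> borel_measurable borel" for k
    unfolding L_def[abs_def] D_def[abs_def] by measurable
  note dct = integrable_dominated_convergence[OF _ _ w ae] integral_dominated_convergence[OF _ _ w ae]
  have L1: "integrable lborel L" by (rule dct) (auto simp: bound)
  have "(\<lambda>k. integral\<^sup>L lborel (D k)) \<longlonglongrightarrow> integral\<^sup>L lborel L" by (rule dct) (auto simp: bound)
  moreover have "(\<lambda>k. integral\<^sup>L lborel (D k)) \<longlonglongrightarrow> (- \<i> * complex_of_real (z \<bullet> v)) * I"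
  proof -
    define c where "c = - \<i> * complex_of_real (z \<bullet> v)"
    have "((\<lambda>u. exp (c * u)) has_field_derivative c) (at 0)"
      by (auto intro!: derivative_eq_intros)
    then have "((\<lambda>u. (exp (c * u) - 1) / u) \<longlongrightarrow> c) (at 0)"
      by (simp add: DERIV_def)
    moreover have "filterlim (\<lambda>k. complex_of_real (h k)) (at 0) sequentially"
      unfolding filterlim_at using tendsto_of_real[OF h0, where 'a = complex] h_nz by simp
    ultimately have "(\<lambda>k. (exp (c * complex_of_real (h k)) - 1) / complex_of_real (h k)) \<longlonglongrightarrow> c"
      by (rule filterlim_compose)
    moreover have "exp (c * complex_of_real (h k)) = cis (- h k * (z \<bullet> v))" for k
      by (simp add: c_def cis_conv_exp mult_ac)
    ultimately have "(\<lambda>k. (cis (- h k * (z \<bullet> v)) - 1) / complex_of_real (h k) * I) \<longlonglongrightarrow> (- \<i> * complex_of_real (z \<bullet> v)) * I"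
      unfolding c_def by (intro tendsto_intros) simp
    then show ?thesis
      using D_int by (simp add: has_bochner_integral_iff)
  qed
  ultimately have "integral\<^sup>L lborel L = (- \<i> * complex_of_real (z \<bullet> v)) * I"
    by (rule LIMSEQ_unique)
  with L1 have "has_bochner_integral lborel L ((- \<i> * complex_of_real (z \<bullet> v)) * I)"
    by (simp add: has_bochner_integral_iff)
  from has_bochner_integral_mult_right[OF this, of "- 1 / complex_of_real y"]
  show ?thesis
    using assms(1) by (simp add: L_def[abs_def] \<phi>_def field_simps)
qed

text \<open>
  Each of the \<open>n\<close> equal factors dominates one coordinate,
  \<open>r\<^sup>2 + |t|\<^sup>2 \<ge> m (1 + t\<^sub>b\<^sup>2)\<close> with \<open>m = min 1 r\<^sup>2\<close>, which reduces the claim to the integrability of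
  \<open>1/(1 + u\<^sup>2)\<close> on the line.  The square of the Cauchy kernel decays exactly like this.
\<close>

lemma integrable_inverse_sum_squares_power:
  assumes "r > 0"
  shows "integrable lborel (\<lambda>t::'a::euclidean_space. 1 / (r\<^sup>2 + (norm t)\<^sup>2) ^ DIM('a))"
proof -
  define m where "m = min 1 (r\<^sup>2)"
  have m: "m > 0" using assms by (simp add: m_def)
  have "integrable lborel (\<lambda>u::real. inverse (1 + u\<^sup>2))"
    using integrable_inverse_1_plus_square by (simp add: set_integrable_def einterval_def)
  then have "has_bochner_integral lborel (\<lambda>u::real. inverse (1 + u\<^sup>2)) (LBINT u. inverse (1 + u\<^sup>2))"
    by (simp add: has_bochner_integral_iff)
  from has_bochner_integral_lborel_prod[OF this]
  have "integrable lborel (\<lambda>t::'a. \<Prod>b\<in>Basis. inverse (1 + (t \<bullet> b)\<^sup>2))"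
    by (rule integrable.intros)
  then have "integrable lborel (\<lambda>t::'a. (1 / m) ^ DIM('a) * (\<Prod>b\<in>Basis. inverse (1 + (t \<bullet> b)\<^sup>2)))"
    by (rule integrable_mult_right)
  moreover have "norm (1 / (r\<^sup>2 + (norm t)\<^sup>2) ^ DIM('a)) \<le>
      norm ((1 / m) ^ DIM('a) * (\<Prod>b\<in>Basis. inverse (1 + (t \<bullet> b)\<^sup>2)))" for t :: 'a
  proof -
    have *: "1 / (r\<^sup>2 + (norm t)\<^sup>2) \<le> (1 / m) * inverse (1 + (t \<bullet> b)\<^sup>2)" if "b \<in> Basis" for b
    proof -
      have "(t \<bullet> b)\<^sup>2 \<le> (norm t)\<^sup>2"
        using Basis_le_norm[OF that, of t] by (simp flip: abs_le_square_iff)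
      then have "m * (1 + (t \<bullet> b)\<^sup>2) \<le> r\<^sup>2 + (norm t)\<^sup>2"
        using mult_right_mono[of m 1 "(t \<bullet> b)\<^sup>2"] by (auto simp: m_def algebra_simps min_def split: if_splits)
      moreover have "m * (1 + (t \<bullet> b)\<^sup>2) > 0" using m by (intro mult_pos_pos add_pos_nonneg) auto
      ultimately have "1 / (r\<^sup>2 + (norm t)\<^sup>2) \<le> 1 / (m * (1 + (t \<bullet> b)\<^sup>2))"
        by (intro frac_le) auto
      then show ?thesis
        by (simp add: inverse_eq_divide)
    qed
    have "(1 / (r\<^sup>2 + (norm t)\<^sup>2)) ^ DIM('a) = (\<Prod>b\<in>(Basis::'a set). 1 / (r\<^sup>2 + (norm t)\<^sup>2))"
      by simp
    also have "\<dots> \<le> (\<Prod>b\<in>Basis. (1 / m) * inverse (1 + (t \<bullet> b)\<^sup>2))"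
      by (intro prod_mono conjI *) auto
    also have "\<dots> = (1 / m) ^ DIM('a) * (\<Prod>b\<in>Basis. inverse (1 + (t \<bullet> b)\<^sup>2))"
      by (simp only: prod.distrib prod_constant)
    finally show ?thesis
      using m by (simp add: power_one_over abs_mult abs_prod power_abs add_nonneg_nonneg prod_nonneg)
  qed
  moreover have "(\<lambda>t::'a. 1 / (r\<^sup>2 + (norm t)\<^sup>2) ^ DIM('a)) \<in> borel_measurable lborel"
    by measurable
  ultimately show ?thesis
    by (blast intro: Bochner_Integration.integrable_bound AE_I2)
qed

section \<open>Bilinear pairings of square integrable functions\<close>

lemma norm_vector_scale: "norm (c *s v) = cmod c * norm v" for v :: "complex ^ 'm::finite"
  by (simp add: norm_vec_def norm_mult L2_set_right_distrib)

lemma bounded_bilinear_vector_scale: "bounded_bilinear ((*s) :: complex \<Rightarrow> complex ^ 'm::finite \<Rightarrow> _)"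
proof
  show "\<exists>K. \<forall>a (b :: complex ^ 'm). norm (a *s b) \<le> norm a * norm b * K"
    by (intro exI[of _ 1]) (simp add: norm_vector_scale)
qed (simp_all add: vec_eq_iff algebra_simps scaleR_conv_of_real[where 'a = complex])

lemma scaleR_eq_vector_scale: "r *\<^sub>R v = complex_of_real r *s v" for v :: "complex ^ 'm::finite"
  by (simp add: vec_eq_iff scaleR_conv_of_real[where 'a = complex])

lemma bounded_bilinear_cmult: "bounded_bilinear ((\<odot>) :: 'n::{finite,linorder} clifford \<Rightarrow> 'n clifford \<Rightarrow> 'n clifford)"
  unfolding bilinear_conv_bounded_bilinear[symmetric] bilinear_def
  by (auto intro!: linearI simp: cmult_add_left cmult_add_right scaleR_eq_vector_scale cmult_scale_left cmult_scale_right)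

lemma borel_measurable_bilinear:
  fixes h :: "'a::euclidean_space \<Rightarrow> 'b::euclidean_space \<Rightarrow> 'c::real_normed_vector"
  assumes "bounded_bilinear h" "f \<in> borel_measurable M" "g \<in> borel_measurable M"
  shows "(\<lambda>x. h (f x) (g x)) \<in> borel_measurable M"
  using assms(2,3)
  by (rule borel_measurable_continuous_Pair)
     (auto intro!: bounded_bilinear.continuous_on[OF assms(1)] continuous_intros)

lemma integrable_bilinear_square_integrable:
  fixes h :: "'a::euclidean_space \<Rightarrow> 'b::euclidean_space \<Rightarrow> 'c::euclidean_space"
    and k :: "'x::euclidean_space \<Rightarrow> 'a" and f :: "'x \<Rightarrow> 'b"
  assumes "bounded_bilinear h" "square_integrable k" "square_integrable f"
  shows "integrable lebesgue (\<lambda>x. h (k x) (f x))"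
proof -
  obtain K where K: "0 < K" "\<And>a b. norm (h a b) \<le> norm a * norm b * K"
    using bounded_bilinear.pos_bounded[OF assms(1)] by auto
  have "integrable lebesgue (\<lambda>x. ((norm (k x))\<^sup>2 + (norm (f x))\<^sup>2) * K)"
    using assms(2,3) unfolding square_integrable_def
    by (intro integrable_mult_left Bochner_Integration.integrable_add) blast+
  then show ?thesis
  proof (rule Bochner_Integration.integrable_bound)
    show "(\<lambda>x. h (k x) (f x)) \<in> borel_measurable lebesgue"
      using assms(2,3) unfolding square_integrable_def
      by (elim conjE) (rule borel_measurable_bilinear[OF assms(1)])
    have "norm (h a b) \<le> ((norm a)\<^sup>2 + (norm b)\<^sup>2) * K" for a b
    proof -
      have "norm a * norm b \<le> (norm a)\<^sup>2 + (norm b)\<^sup>2"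
        using sum_squares_bound[of "norm a" "norm b"] mult_nonneg_nonneg[OF norm_ge_zero[of a] norm_ge_zero[of b]]
        by linarith
      then show ?thesis
        using order_trans[OF K(2)[of a b] mult_right_mono[of "norm a * norm b" _ K]] K(1) by simp
    qed
    then show "AE x in lebesgue. norm (h (k x) (f x)) \<le> norm (((norm (k x))\<^sup>2 + (norm (f x))\<^sup>2) * K)"
      using K(1) by (simp add: abs_mult)
  qed
qed

text \<open>
  Pairing with a fixed square integrable kernel is continuous in \<open>L\<^sup>2\<close>, by the Cauchy-Schwarz
  inequality.  The \<open>v j\<close> are only assumed measurable, because they will be linear canonical
  transforms of integrable functions, whose square integrability is not known beforehand.
\<close>

lemma tendsto_integral_bilinear_square_integrable:
  fixes h :: "'a::euclidean_space \<Rightarrow> 'b::euclidean_space \<Rightarrow> 'c::euclidean_space"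
    and k :: "'x::euclidean_space \<Rightarrow> 'a" and f :: "'x \<Rightarrow> 'b"
  assumes h: "bounded_bilinear h" and k: "square_integrable k" and f: "square_integrable f"
    and v: "\<And>j. v j \<in> borel_measurable lebesgue"
    and lim: "(\<lambda>j. \<integral>\<^sup>+x. ennreal ((norm (v j x - f x))\<^sup>2) \<partial>lebesgue) \<longlonglongrightarrow> 0"
  shows "(\<lambda>j. LINT x|lebesgue. h (k x) (v j x)) \<longlonglongrightarrow> (LINT x|lebesgue. h (k x) (f x))"
proof -
  interpret bounded_bilinear h by (rule h)
  obtain K where K: "0 < K" "\<And>a b. norm (h a b) \<le> norm a * norm b * K"
    using pos_bounded by auto
  have [measurable]: "k \<in> borel_measurable lebesgue" "f \<in> borel_measurable lebesgue" "\<And>j. v j \<in> borel_measurable lebesgue"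
    using k f v by (auto simp: square_integrable_def)
  define A where "A = (\<integral>\<^sup>+x. ennreal ((norm (k x))\<^sup>2) \<partial>lebesgue)"
  define N where "N j = (\<integral>\<^sup>+x. ennreal ((norm (v j x - f x))\<^sup>2) \<partial>lebesgue)" for j
  define a where "a = (\<lambda>j. LINT x|lebesgue. h (k x) (v j x))"
  define l where "l = (LINT x|lebesgue. h (k x) (f x))"
  define d where "d j = norm (a j - l)" for j
  have A: "A < \<infinity>"
    using k by (auto simp: A_def square_integrable_def integrable_iff_bounded)
  have "\<forall>\<^sub>F j in sequentially. N j < \<infinity>"
    using lim unfolding N_def by (rule order_tendstoD) simp
  then have le: "\<forall>\<^sub>F j in sequentially. ennreal ((d j)\<^sup>2) \<le> (ennreal (K\<^sup>2) * A) * N j"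
  proof eventually_elim
    case (elim j)
    have sq: "square_integrable (\<lambda>x. v j x - f x)"
      using elim by (auto simp: square_integrable_def integrable_iff_bounded N_def)
    note I = integrable_bilinear_square_integrable[OF h k]
    have J: "integrable lebesgue (\<lambda>x. h (k x) (v j x))"
      using Bochner_Integration.integrable_add[OF I[OF sq] I[OF f]] by (simp flip: add_right)
    have "d j = norm (LINT x|lebesgue. h (k x) (v j x - f x))"
      unfolding d_def a_def l_def diff_right using J I[OF f] by simp
    also have "ennreal \<dots> \<le> (\<integral>\<^sup>+x. norm (h (k x) (v j x - f x)) \<partial>lebesgue)"
      by (rule integral_norm_bound_ennreal[OF I[OF sq]])
    also have "\<dots> \<le> (\<integral>\<^sup>+x. ennreal K * (ennreal (norm (k x)) * ennreal (norm (v j x - f x))) \<partial>lebesgue)"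
      using K by (intro nn_integral_mono) (simp add: mult_ac flip: ennreal_mult)
    also have "\<dots> = ennreal K * (\<integral>\<^sup>+x. ennreal (norm (k x)) * ennreal (norm (v j x - f x)) \<partial>lebesgue)"
      by (rule nn_integral_cmult) measurable
    finally have "(ennreal (d j))\<^sup>2 \<le> (ennreal K * (\<integral>\<^sup>+x. ennreal (norm (k x)) * ennreal (norm (v j x - f x)) \<partial>lebesgue))\<^sup>2"
      by (rule power_mono) simp
    also have "\<dots> = (ennreal K)\<^sup>2 * (\<integral>\<^sup>+x. ennreal (norm (k x)) * ennreal (norm (v j x - f x)) \<partial>lebesgue)\<^sup>2"
      by (rule power_mult_distrib)
    also have "\<dots> \<le> (ennreal K)\<^sup>2 * ((\<integral>\<^sup>+x. (ennreal (norm (k x)))\<^sup>2 \<partial>lebesgue) * (\<integral>\<^sup>+x. (ennreal (norm (v j x - f x)))\<^sup>2 \<partial>lebesgue))"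
      by (intro mult_left_mono Cauchy_Schwarz_nn_integral) measurable
    finally show ?case
      using K(1) by (simp add: A_def N_def ennreal_power d_def mult.assoc)
  qed
  have "(\<lambda>j. (ennreal (K\<^sup>2) * A) * N j) \<longlonglongrightarrow> (ennreal (K\<^sup>2) * A) * 0"
    using lim A unfolding N_def by (intro ennreal_tendsto_cmult) (auto simp: ennreal_mult_less_top)
  then have "(\<lambda>j. ennreal ((d j)\<^sup>2)) \<longlonglongrightarrow> 0"
    using le by (intro tendsto_sandwich[of "\<lambda>_. 0", OF _ le]) auto
  then have "(\<lambda>j. (d j)\<^sup>2) \<longlonglongrightarrow> 0"
    by (subst (asm) ennreal_tendsto_0_iff) auto
  then have "(\<lambda>j. sqrt ((d j)\<^sup>2)) \<longlonglongrightarrow> sqrt 0"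
    by (rule tendsto_real_sqrt)
  moreover have "sqrt ((d j)\<^sup>2) = d j" for j
    unfolding d_def by (simp only: real_sqrt_abs abs_norm_cancel)
  ultimately have "d \<longlonglongrightarrow> 0"
    by (simp only: real_sqrt_zero)
  then have "(\<lambda>j. norm (a j - l)) \<longlonglongrightarrow> 0"
    by (simp only: d_def[abs_def])
  then have "a \<longlonglongrightarrow> l"
    unfolding tendsto_norm_zero_iff by (rule LIM_zero_cancel)
  then show ?thesis
    unfolding a_def l_def .
qed

section \<open>The monogenic exponential and the Cauchy kernel\<close>

text \<open>
  Twice the monogenic extension to the half-space \<open>y > 0\<close> of the Hardy projection of the plane wave
  \<open>e\<^bsup>i\<langle>z,\<xi>\<rangle>\<^esup>\<close>: since \<open>(i\<xi>/|\<xi>|)\<^sup>2 = 1\<close>, the factor \<open>1 + i\<xi>/|\<xi>|\<close> is twice an idempotent.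
\<close>

definition monogenic_exponential :: "real \<Rightarrow> real ^ 'n \<Rightarrow> real ^ 'n \<Rightarrow> ('n::finite) clifford" where
  "monogenic_exponential y z \<xi> =
     (complex_of_real (exp (- y * norm \<xi>)) * cis (z \<bullet> \<xi>)) *s (cblade {} + \<i> *s cvec (\<xi> /\<^sub>R norm \<xi>))"

text \<open>
  The Cauchy kernel of the generalised Cauchy-Riemann operator on para-vectors, with twice the usual
  constant, so that it is the sum of the Poisson and the conjugate Poisson kernel
  (\<open>cauchy_kernel_eq\<close>).
\<close>

definition cauchy_kernel :: "real \<Rightarrow> real ^ 'n \<Rightarrow> ('n::finite) clifford" where
  "cauchy_kernel y z =
     (poisson_constant CARD('n) / norm (paravec y z) ^ (CARD('n) + 1)) *\<^sub>R paravec_conj y z"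

lemma norm_paravec_eq: "norm (paravec y z) = sqrt (y\<^sup>2 + (norm z)\<^sup>2)"
  by (metis norm_ge_zero norm_paravec real_sqrt_unique)

lemma monogenic_exponential_fourier:
  fixes z :: "real ^ 'n::finite"
  assumes "y > 0"
  shows "has_bochner_integral lborel (monogenic_exponential y z) ((2 * pi) ^ CARD('n) *\<^sub>R cauchy_kernel y z)"
proof -
  define I where "I = complex_of_real ((2 * pi) ^ CARD('n) *
      (poisson_constant CARD('n) * (y / sqrt (y\<^sup>2 + (norm z)\<^sup>2) ^ (CARD('n) + 1))))"
  have lin: "bounded_linear (\<lambda>c::complex. c *s (v :: 'n clifford))" for v
    by (rule bounded_bilinear.bounded_linear_left[OF bounded_bilinear_vector_scale])
  have P: "has_bochner_integral lborel (\<lambda>\<xi>. complex_of_real (exp (- y * norm \<xi>)) * cis (z \<bullet> \<xi>)) I"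
    using poisson_fourier[OF assms, of z] unfolding I_def by (simp only: DIM_cart DIM_real mult_1_right)
  have R: "has_bochner_integral lborel
      (\<lambda>\<xi>. complex_of_real (exp (- y * norm \<xi>) * ((\<xi> \<bullet> axis j 1) / norm \<xi>)) * cis (z \<bullet> \<xi>))
      (\<i> * complex_of_real ((z \<bullet> axis j 1) / y) * I)" for j
    using riesz_poisson_fourier[OF assms, where z = z and v = "axis j 1"]
    unfolding I_def by (simp only: DIM_cart DIM_real mult_1_right)
  have "has_bochner_integral lborel
      (\<lambda>\<xi>. (complex_of_real (exp (- y * norm \<xi>)) * cis (z \<bullet> \<xi>)) *s (cblade {} :: 'n clifford) +
        (\<Sum>j\<in>UNIV. (\<i> * (complex_of_real (exp (- y * norm \<xi>) * ((\<xi> \<bullet> axis j 1) / norm \<xi>)) * cis (z \<bullet> \<xi>))) *s cblade {j}))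
      (I *s cblade {} + (\<Sum>j\<in>UNIV. (\<i> * (\<i> * complex_of_real ((z \<bullet> axis j 1) / y) * I)) *s cblade {j}))"
    by (intro has_bochner_integral_add has_bochner_integral_sum has_bochner_integral_bounded_linear[OF lin]
         has_bochner_integral_mult_right P R)
  moreover have "(complex_of_real (exp (- y * norm \<xi>)) * cis (z \<bullet> \<xi>)) *s (cblade {} :: 'n clifford) +
        (\<Sum>j\<in>UNIV. (\<i> * (complex_of_real (exp (- y * norm \<xi>) * ((\<xi> \<bullet> axis j 1) / norm \<xi>)) * cis (z \<bullet> \<xi>))) *s cblade {j})
     = monogenic_exponential y z \<xi>" for \<xi> :: "real ^ 'n"
  proof -
    have "\<i> * (complex_of_real (exp (- y * norm \<xi>) * ((\<xi> \<bullet> axis j 1) / norm \<xi>)) * cis (z \<bullet> \<xi>)) =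
        complex_of_real (exp (- y * norm \<xi>)) * cis (z \<bullet> \<xi>) * (\<i> * complex_of_real ((\<xi> /\<^sub>R norm \<xi>) $ j))" for j
      by (simp add: inner_axis divide_inverse)
    then show ?thesis
      unfolding monogenic_exponential_def cvec_def vec.scale_right_distrib vec.scale_sum_right vec.scale_scale
      by (simp only:)
  qed
  moreover have "I *s cblade {} + (\<Sum>j\<in>UNIV. (\<i> * (\<i> * complex_of_real ((z \<bullet> axis j 1) / y) * I)) *s cblade {j})
     = (2 * pi) ^ CARD('n) *\<^sub>R cauchy_kernel y z"
  proof -
    define m where "m = (2 * pi) ^ CARD('n) * (poisson_constant CARD('n) / norm (paravec y z) ^ (CARD('n) + 1))"
    have I: "I = complex_of_real (m * y)"
      by (simp add: I_def m_def norm_paravec_eq)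
    have "\<i> * (\<i> * complex_of_real ((z \<bullet> axis j 1) / y) * I) = - complex_of_real (m * z $ j)" for j
      using assms by (simp add: I inner_axis)
    then have "I *s cblade {} + (\<Sum>j\<in>UNIV. (\<i> * (\<i> * complex_of_real ((z \<bullet> axis j 1) / y) * I)) *s cblade {j})
      = complex_of_real m *s paravec_conj y z"
      by (simp add: I paravec_conj_def cvec_def vec.scale_right_diff_distrib vec.scale_sum_right vec.scale_scale sum_negf)
    also have "\<dots> = (2 * pi) ^ CARD('n) *\<^sub>R cauchy_kernel y z"
      by (simp only: cauchy_kernel_def m_def scaleR_eq_vector_scale[symmetric] scaleR_scaleR)
    finally show ?thesis .
  qed
  ultimately show ?thesis by (simp only:)
qed

lemma cvec_nth: "cvec v $ T = (\<Sum>j\<in>UNIV. complex_of_real (v $ j) * (if T = {j} then 1 else 0))"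
  by (simp add: cvec_def cblade_nth)

lemma bounded_linear_cvec: "bounded_linear cvec"
  unfolding linear_conv_bounded_linear[symmetric]
  by (rule linearI) (simp_all add: vec_eq_iff cvec_nth scaleR_conv_of_real[where 'a = complex]
     sum_distrib_left distrib_right sum.distrib mult.assoc)

lemma borel_measurable_cvec [measurable]: "cvec \<in> borel_measurable borel"
  by (intro borel_measurable_continuous_onI bounded_linear.continuous_on[OF bounded_linear_cvec] continuous_intros)

lemma borel_measurable_paravec [measurable]:
  "paravec y \<in> borel_measurable borel" "paravec_conj y \<in> borel_measurable borel"
  unfolding paravec_def[abs_def] paravec_conj_def[abs_def] by measurable

lemma paravec_conj_eq: "paravec_conj y z = paravec y (- z)"
  by (simp add: paravec_conj_def paravec_def linear_neg[OF bounded_linear.linear[OF bounded_linear_cvec]])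

lemma norm_paravec_conj: "norm (paravec_conj y z) = norm (paravec y z)"
  by (simp add: paravec_conj_eq norm_paravec_eq)

lemma norm_cvec: "norm (cvec v) = norm v"
  using norm_paravec[of 0 v] by (simp add: paravec_def)

lemma norm_cblade_empty: "norm (cblade {}) = 1"
  by (simp add: cblade_def)

lemma norm_monogenic_exponential_le: "norm (monogenic_exponential y z \<xi>) \<le> 2 * exp (- y * norm \<xi>)"
proof -
  have "norm (cblade {} + \<i> *s cvec (\<xi> /\<^sub>R norm \<xi>)) \<le> 1 + norm (\<xi> /\<^sub>R norm \<xi>)"
    by (rule order_trans[OF norm_triangle_ineq]) (simp add: norm_cblade_empty norm_vector_scale norm_cvec)
  also have "\<dots> \<le> 2"
    by (cases "\<xi> = 0") auto
  finally show ?thesis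
    unfolding monogenic_exponential_def norm_vector_scale norm_mult by simp
qed

text \<open>
  This is how the phase of the linear canonical transform is absorbed: multiplying by it evaluates
  the exponential at a shifted point, and after integration over \<open>\<xi>\<close> turns the Cauchy kernel into
  a convolution kernel.
\<close>

lemma monogenic_exponential_shift:
  "monogenic_exponential y (z - w) \<xi> = cis (- (w \<bullet> \<xi>)) *s monogenic_exponential y z \<xi>"
proof -
  have "cis ((z - w) \<bullet> \<xi>) = cis (- (w \<bullet> \<xi>)) * cis (z \<bullet> \<xi>)"
    by (simp add: cis_mult inner_diff_left)
  then show ?thesis
    by (simp only: monogenic_exponential_def vec.scale_scale mult_ac)
qed

lemma integrable_exp_minus_norm:
  assumes "y > 0"
  shows "integrable lborel (\<lambda>\<xi>::'a::euclidean_space. exp (- y * norm \<xi>))"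
  using has_bochner_integral_bounded_linear[OF bounded_linear_Re poisson_fourier[OF assms, of "0::'a"]]
  by (auto simp: has_bochner_integral_iff)

lemma borel_measurable_lebesgue_if_borel:
  "f \<in> borel_measurable borel \<Longrightarrow> f \<in> borel_measurable lebesgue"
  by (auto intro: measurable_completion)

lemma square_integrable_monogenic_exponential:
  fixes z :: "real ^ 'n::finite"
  assumes "y > 0"
  shows "square_integrable (monogenic_exponential y z)"
proof -
  have M: "monogenic_exponential y z \<in> borel_measurable borel"
    using monogenic_exponential_fourier[OF assms, of z] by (auto simp: has_bochner_integral_iff dest: borel_measurable_integrable)
  have "integrable lborel (\<lambda>\<xi>::real^'n. 4 * exp (- (2 * y) * norm \<xi>))"
    using assms by (intro integrable_mult_right integrable_exp_minus_norm) simp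
  then have "integrable lborel (\<lambda>\<xi>. (norm (monogenic_exponential y z \<xi>))\<^sup>2)"
  proof (rule Bochner_Integration.integrable_bound)
    show "(\<lambda>\<xi>. (norm (monogenic_exponential y z \<xi>))\<^sup>2) \<in> borel_measurable lborel"
      using M by measurable
    show "AE \<xi> in lborel. norm ((norm (monogenic_exponential y z \<xi>))\<^sup>2) \<le> norm (4 * exp (- (2 * y) * norm \<xi>))"
    proof (rule AE_I2)
      fix \<xi> :: "real^'n"
      have "(norm (monogenic_exponential y z \<xi>))\<^sup>2 \<le> (2 * exp (- y * norm \<xi>))\<^sup>2"
        by (intro power_mono norm_monogenic_exponential_le) simp
      also have "\<dots> = 4 * exp (- (2 * y) * norm \<xi>)"
        by (simp add: power_mult_distrib flip: exp_double)
      finally show "norm ((norm (monogenic_exponential y z \<xi>))\<^sup>2) \<le> norm (4 * exp (- (2 * y) * norm \<xi>))"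
        by simp
    qed
  qed
  moreover have "(\<lambda>\<xi>. (norm (monogenic_exponential y z \<xi>))\<^sup>2) \<in> borel_measurable lborel"
    using M by measurable
  ultimately show ?thesis
    using borel_measurable_lebesgue_if_borel[OF M] by (simp add: square_integrable_def integrable_completion)
qed

text \<open>
  All three Poisson type kernels decay like \<open>|z|\<^bsup>-n\<^esup>\<close> and are bounded near the origin, which is
  enough for square integrability in dimension \<open>n\<close>.
\<close>

lemma square_integrable_poisson_decay:
  fixes \<phi> :: "real ^ 'n::finite \<Rightarrow> 'b::euclidean_space"
  assumes y: "y > 0" and M: "\<phi> \<in> borel_measurable borel"
    and le: "\<And>z. norm (\<phi> z) \<le> C / sqrt (y\<^sup>2 + (norm z)\<^sup>2) ^ CARD('n)"
  shows "square_integrable (\<lambda>t. \<phi> (x - t))"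
proof -
  have "has_bochner_integral lborel (\<lambda>t::real^'n. 1 / (y\<^sup>2 + (norm t)\<^sup>2) ^ CARD('n))
      (LINT t|lborel. 1 / (y\<^sup>2 + (norm (t::real^'n))\<^sup>2) ^ CARD('n))"
    using integrable_inverse_sum_squares_power[OF y, where 'a = "real^'n"] by (simp add: has_bochner_integral_iff)
  from has_bochner_integral_lborel_translate[OF this, of "- x"]
  have "integrable lborel (\<lambda>t::real^'n. 1 / (y\<^sup>2 + (norm (- x + t))\<^sup>2) ^ CARD('n))"
    by (rule integrable.intros)
  then have "integrable lborel (\<lambda>t. C\<^sup>2 * (1 / (y\<^sup>2 + (norm (- x + t))\<^sup>2) ^ CARD('n)))"
    by (rule integrable_mult_right)
  moreover have "norm ((norm (\<phi> (x - t)))\<^sup>2) \<le> norm (C\<^sup>2 * (1 / (y\<^sup>2 + (norm (- x + t))\<^sup>2) ^ CARD('n)))" for t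
  proof -
    have "(norm (\<phi> (x - t)))\<^sup>2 \<le> (C / sqrt (y\<^sup>2 + (norm (x - t))\<^sup>2) ^ CARD('n))\<^sup>2"
      by (intro power_mono le) simp
    also have "\<dots> = C\<^sup>2 * (1 / (y\<^sup>2 + (norm (- x + t))\<^sup>2) ^ CARD('n))"
      by (simp add: power_divide power_commutes[of _ 2] norm_minus_commute power_mult[symmetric] mult.commute[of _ 2])
         (simp add: power_mult norm_minus_commute)
    finally show ?thesis by simp
  qed
  moreover have M': "(\<lambda>t. \<phi> (x - t)) \<in> borel_measurable borel"
    using M by measurable
  moreover have M2: "(\<lambda>t. (norm (\<phi> (x - t)))\<^sup>2) \<in> borel_measurable lborel"
    using M' by measurable
  ultimately have "integrable lborel (\<lambda>t. (norm (\<phi> (x - t)))\<^sup>2)"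
    by (blast intro: Bochner_Integration.integrable_bound AE_I2)
  then show ?thesis
    using borel_measurable_lebesgue_if_borel[OF M'] M2 by (simp add: square_integrable_def integrable_completion)
qed

lemma poisson_constant_nonneg: "poisson_constant n \<ge> 0"
  by (simp add: poisson_constant_def Gamma_real_nonneg)

lemma norm_poisson_kernels_le:
  fixes z :: "real ^ 'n::finite"
  assumes "y > 0"
  shows "norm (cauchy_kernel y z) \<le> poisson_constant CARD('n) / sqrt (y\<^sup>2 + (norm z)\<^sup>2) ^ CARD('n)"
    and "norm (poisson_kernel y z) \<le> poisson_constant CARD('n) / sqrt (y\<^sup>2 + (norm z)\<^sup>2) ^ CARD('n)"
    and "norm (conj_poisson_kernel y z) \<le> poisson_constant CARD('n) / sqrt (y\<^sup>2 + (norm z)\<^sup>2) ^ CARD('n)"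
proof -
  define R where "R = sqrt (y\<^sup>2 + (norm z)\<^sup>2)"
  have R: "R > 0" "y \<le> R" "norm z \<le> R"
    using assms by (auto simp: R_def add_pos_nonneg real_le_rsqrt)
  have step: "poisson_constant CARD('n) * (r / R ^ (CARD('n) + 1)) \<le> poisson_constant CARD('n) / R ^ CARD('n)"
    if "r \<le> R" for r
  proof -
    have "r / R ^ (CARD('n) + 1) \<le> R / R ^ (CARD('n) + 1)"
      using that R by (intro divide_right_mono) auto
    also have "\<dots> = 1 / R ^ CARD('n)"
      using R by simp
    finally have "poisson_constant CARD('n) * (r / R ^ (CARD('n) + 1)) \<le> poisson_constant CARD('n) * (1 / R ^ CARD('n))"
      by (rule mult_left_mono) (rule poisson_constant_nonneg)
    then show ?thesis by simp
  qed
  have n: "norm (paravec y z) = R" "norm (paravec_conj 0 z) = norm z"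
    by (simp_all add: R_def norm_paravec_eq norm_paravec_conj)
  show "norm (cauchy_kernel y z) \<le> poisson_constant CARD('n) / sqrt (y\<^sup>2 + (norm z)\<^sup>2) ^ CARD('n)"
    using step[of R] poisson_constant_nonneg[of "CARD('n)"] R unfolding R_def[symmetric]
    by (simp add: cauchy_kernel_def n norm_paravec_conj)
  show "norm (poisson_kernel y z) \<le> poisson_constant CARD('n) / sqrt (y\<^sup>2 + (norm z)\<^sup>2) ^ CARD('n)"
    using step[of y] poisson_constant_nonneg[of "CARD('n)"] R assms unfolding R_def[symmetric]
    by (simp add: poisson_kernel_def poisson_constant_def[symmetric] n abs_mult)
  show "norm (conj_poisson_kernel y z) \<le> poisson_constant CARD('n) / sqrt (y\<^sup>2 + (norm z)\<^sup>2) ^ CARD('n)"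
  proof -
    have "norm (conj_poisson_kernel y z) = poisson_constant CARD('n) * (norm z / R ^ (CARD('n) + 1))"
      unfolding conj_poisson_kernel_def poisson_constant_def[symmetric] norm_scaleR n
      using R(1) poisson_constant_nonneg[of "CARD('n)"] by (simp add: divide_inverse)
    then show ?thesis
      using step[OF R(3)] unfolding R_def[symmetric] by (simp only:)
  qed
qed

lemma borel_measurable_kernels [measurable]:
  "cauchy_kernel y \<in> borel_measurable borel"
  "poisson_kernel y \<in> borel_measurable borel"
  "conj_poisson_kernel y \<in> borel_measurable borel"
  unfolding cauchy_kernel_def[abs_def] poisson_kernel_def[abs_def] conj_poisson_kernel_def[abs_def]
  by measurable

lemma cauchy_kernel_eq:
  "cauchy_kernel y z = poisson_kernel y z *\<^sub>R cblade {} + conj_poisson_kernel y z"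
proof -
  have "paravec_conj y z = y *\<^sub>R cblade {} + paravec_conj 0 z"
    by (simp add: paravec_conj_def scaleR_eq_vector_scale)
  then show ?thesis
    unfolding cauchy_kernel_def poisson_kernel_def conj_poisson_kernel_def poisson_constant_def[symmetric]
    by (simp only: scaleR_add_right scaleR_scaleR divide_inverse) (simp only: mult_ac)
qed

lemma cauchy_kernel_cmult:
  "cauchy_kernel y z \<odot> v = poisson_kernel y z *\<^sub>R v + conj_poisson_kernel y z \<odot> v"
  by (simp only: cauchy_kernel_eq cmult_add_left scaleR_eq_vector_scale cmult_scale_left cmult_one_left)

lemma cauchy_kernel_scale:
  fixes z :: "real ^ 'n::finite"
  assumes "b > 0"
  shows "cauchy_kernel (y / b) (z /\<^sub>R b) = b ^ CARD('n) *\<^sub>R cauchy_kernel y z"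
proof -
  have "norm (paravec (y / b) (z /\<^sub>R b)) = norm (paravec y z) / b"
  proof -
    have "(y / b)\<^sup>2 + (norm (z /\<^sub>R b))\<^sup>2 = (y\<^sup>2 + (norm z)\<^sup>2) / b\<^sup>2"
      using assms by (simp add: power_divide power_mult_distrib power_inverse divide_inverse algebra_simps)
    then show ?thesis
      using assms by (simp add: norm_paravec_eq real_sqrt_divide)
  qed
  moreover have "paravec_conj (y / b) (z /\<^sub>R b) = (1 / b) *\<^sub>R paravec_conj y z"
  proof -
    have "cvec (z /\<^sub>R b) = (1 / b) *\<^sub>R cvec z"
      using linear_scale[OF bounded_linear.linear[OF bounded_linear_cvec], of "1 / b" z]
      by (simp only: inverse_eq_divide)
    moreover have "complex_of_real (y / b) *s cblade {} = (1 / b) *\<^sub>R (complex_of_real y *s cblade {} :: 'n clifford)"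
      by (simp only: scaleR_eq_vector_scale vec.scale_scale of_real_mult[symmetric] mult_1_left times_divide_eq_left)
    ultimately show ?thesis
      by (simp only: paravec_conj_def scaleR_diff_right)
  qed
  ultimately show ?thesis
    using assms by (simp add: cauchy_kernel_def power_divide)
qed

section \<open>Exchanging the two integrals\<close>

text \<open>
  The functions to be integrated are Lebesgue measurable and possibly not Borel measurable, so
  Fubini's theorem is applied to the product of the completed measures.
\<close>

lemma sigma_finite_lebesgue: "sigma_finite_measure (lebesgue :: 'a::euclidean_space measure)"
proof
  obtain A :: "'a set set" where A: "countable A" "A \<subseteq> sets lborel" "\<Union>A = space lborel"
      "\<forall>a\<in>A. emeasure lborel a \<noteq> \<infinity>"
    using lborel.sigma_finite_countable by blast
  then show "\<exists>A. countable A \<and> A \<subseteq> sets lebesgue \<and> \<Union>A = space (lebesgue :: 'a measure) \<and>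
      (\<forall>a\<in>A. emeasure lebesgue a \<noteq> \<infinity>)"
    by (intro exI[of _ A]) (auto simp: subset_iff)
qed

interpretation lebesgue_pair: pair_sigma_finite "lebesgue :: 'a::euclidean_space measure" "lebesgue :: 'b::euclidean_space measure"
  by (simp add: pair_sigma_finite_def sigma_finite_lebesgue)

lemma borel_measurable_lebesgue_pair:
  "fst \<in> borel_measurable ((lebesgue :: 'a::euclidean_space measure) \<Otimes>\<^sub>M (lebesgue :: 'b::euclidean_space measure))"
  "snd \<in> borel_measurable ((lebesgue :: 'a measure) \<Otimes>\<^sub>M (lebesgue :: 'b measure))"
  by (auto intro: measurable_compose[OF measurable_fst borel_measurable_lebesgue_if_borel[of "\<lambda>x. x"]]
      measurable_compose[OF measurable_snd borel_measurable_lebesgue_if_borel[of "\<lambda>x. x"]])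

lemma integrable_phase:
  fixes c :: "'x \<Rightarrow> complex" and u :: "'x \<Rightarrow> complex ^ 'm::finite"
  assumes "integrable M u" "c \<in> borel_measurable M" "\<And>t. cmod (c t) = 1"
  shows "integrable M (\<lambda>t. c t *s u t)"
  using assms(1)
proof (rule Bochner_Integration.integrable_bound)
  show "(\<lambda>t. c t *s u t) \<in> borel_measurable M"
    by (rule borel_measurable_bilinear[OF bounded_bilinear_vector_scale assms(2) borel_measurable_integrable[OF assms(1)]])
qed (simp add: norm_vector_scale assms(3))

text \<open>
  The linear canonical transform is chirp multiplication, a scaled Fourier transform, and a second
  chirp multiplication; the inverse of the second chirp cancels it.
\<close>

lemma lct_eq_fourier:
  fixes u :: "real ^ 'n::{finite,linorder} \<Rightarrow> 'n clifford"
  assumes "integrable lebesgue u"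
  shows "exp (- \<i> * complex_of_real (d / (2 * b) * (norm \<xi>)\<^sup>2)) *s lct a b c d u \<xi> =
    (LINT t|lebesgue. cis (- ((t /\<^sub>R b) \<bullet> \<xi>)) *s ((1 / csqrt (\<i> * 2 * pi * b) ^ CARD('n)) *s
      (exp (\<i> * complex_of_real (a / (2 * b) * (norm t)\<^sup>2)) *s u t)))"
proof -
  define E where "E = exp (\<i> * complex_of_real (d / (2 * b) * (norm \<xi>)\<^sup>2))"
  define C where "C = 1 / csqrt (\<i> * 2 * pi * b) ^ CARD('n)"
  define v where "v t = cis (- ((t /\<^sub>R b) \<bullet> \<xi>)) *s (exp (\<i> * complex_of_real (a / (2 * b) * (norm t)\<^sup>2)) *s u t)" for t
  have v: "integrable lebesgue v"
    unfolding v_def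
    by (intro integrable_phase assms borel_measurable_lebesgue_if_borel) (simp_all add: norm_exp_i_times)
  have "lct a b c d u \<xi> = (LINT t|lebesgue. (C * E) *s v t)"
    unfolding lct_def
  proof (rule Bochner_Integration.integral_cong[OF refl])
    fix t
    have "exp (\<i> * complex_of_real (d / (2 * b) * (norm \<xi>)\<^sup>2 - 1 / b * (\<xi> \<bullet> t) + a / (2 * b) * (norm t)\<^sup>2))
      = E * (cis (- ((t /\<^sub>R b) \<bullet> \<xi>)) * exp (\<i> * complex_of_real (a / (2 * b) * (norm t)\<^sup>2)))"
    proof -
      have phase: "exp (\<i> * complex_of_real (A - B + D)) = exp (\<i> * complex_of_real A) * (cis (- B) * exp (\<i> * complex_of_real D))"
        for A B D
        by (simp add: cis_conv_exp algebra_simps flip: exp_add)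
      have "(t /\<^sub>R b) \<bullet> \<xi> = 1 / b * (\<xi> \<bullet> t)"
        by (simp add: inner_commute divide_inverse)
      then show ?thesis
        by (simp only: E_def phase)
    qed
    then show "(1 / csqrt (\<i> * 2 * pi * b) ^ CARD('n) *
        exp (\<i> * complex_of_real (d / (2 * b) * (norm \<xi>)\<^sup>2 - 1 / b * (\<xi> \<bullet> t) + a / (2 * b) * (norm t)\<^sup>2))) *s u t
      = (C * E) *s v t"
      by (simp only: v_def C_def vec.scale_scale mult.assoc)
  qed
  also have "\<dots> = (C * E) *s (LINT t|lebesgue. v t)"
    by (rule integral_bounded_linear[OF bounded_bilinear.bounded_linear_right[OF bounded_bilinear_vector_scale] v])
  finally have "lct a b c d u \<xi> = (C * E) *s (LINT t|lebesgue. v t)" .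
  moreover have "exp (- \<i> * complex_of_real (d / (2 * b) * (norm \<xi>)\<^sup>2)) * (C * E) = C"
    by (simp add: E_def mult.left_commute flip: exp_add)
  ultimately have "exp (- \<i> * complex_of_real (d / (2 * b) * (norm \<xi>)\<^sup>2)) *s lct a b c d u \<xi> = C *s (LINT t|lebesgue. v t)"
    by (simp only: vec.scale_scale)
  also have "\<dots> = (LINT t|lebesgue. C *s v t)"
    by (rule integral_bounded_linear[OF bounded_bilinear.bounded_linear_right[OF bounded_bilinear_vector_scale] v, symmetric])
  finally show ?thesis
    by (simp only: C_def v_def vec.scale_scale mult.left_commute)
qed

lemma integrable_lebesgue_pair_mult:
  fixes g :: "'a::euclidean_space \<Rightarrow> real" and h :: "'b::euclidean_space \<Rightarrow> real"
  assumes "integrable lebesgue g" "integrable lebesgue h"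
  shows "integrable (lebesgue \<Otimes>\<^sub>M lebesgue) (\<lambda>p. g (fst p) * h (snd p))"
proof (rule lebesgue_pair.Fubini_integrable)
  show "(\<lambda>p. g (fst p) * h (snd p)) \<in> borel_measurable (lebesgue \<Otimes>\<^sub>M lebesgue)"
    by (intro borel_measurable_times measurable_compose[OF measurable_fst] measurable_compose[OF measurable_snd]
        borel_measurable_integrable assms)
  have "integrable lebesgue (\<lambda>x. norm (g x) * (LINT y|lebesgue. norm (h y)))"
    using assms by (intro integrable_mult_left integrable_norm)
  then show "integrable lebesgue (\<lambda>x. LINT y|lebesgue. norm (g (fst (x, y)) * h (snd (x, y))))"
    by (simp add: abs_mult)
  show "AE x in lebesgue. integrable lebesgue (\<lambda>y. g (fst (x, y)) * h (snd (x, y)))"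
    using assms(2) by simp
qed

text \<open>
  The transform is moved from \<open>w\<close> onto the kernel.  The double integral converges absolutely because
  the exponential is bounded by \<open>2e\<^bsup>-y|\<xi>|\<^esup>\<close> and \<open>w\<close> is integrable.
\<close>

lemma monogenic_exponential_fubini:
  fixes w :: "real ^ 'n::{finite,linorder} \<Rightarrow> 'n clifford"
  assumes y: "y > 0" and w: "integrable lebesgue w" and s: "s \<in> borel_measurable borel"
  shows "(LINT \<xi>|lebesgue. monogenic_exponential y z \<xi> \<odot> (LINT t|lebesgue. cis (- (s t \<bullet> \<xi>)) *s w t)) =
     (LINT t|lebesgue. (2 * pi) ^ CARD('n) *\<^sub>R (cauchy_kernel y (z - s t) \<odot> w t))"
proof -
  interpret cm: bounded_bilinear "(\<odot>) :: 'n clifford \<Rightarrow> 'n clifford \<Rightarrow> 'n clifford"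
    by (rule bounded_bilinear_cmult)
  define f where "f \<xi> t = monogenic_exponential y z \<xi> \<odot> (cis (- (s t \<bullet> \<xi>)) *s w t)" for \<xi> t
  have f_eq: "f \<xi> t = monogenic_exponential y (z - s t) \<xi> \<odot> w t" for \<xi> t
    by (simp only: f_def monogenic_exponential_shift cmult_scale_left cmult_scale_right)
  obtain K where K: "0 < K" "\<And>a b :: 'n clifford. norm (a \<odot> b) \<le> norm a * norm b * K"
    using cm.pos_bounded by auto
  have E: "has_bochner_integral lebesgue (monogenic_exponential y z') ((2 * pi) ^ CARD('n) *\<^sub>R cauchy_kernel y z')" for z' :: "(real, 'n) vec"
    using monogenic_exponential_fourier[OF y, of z'] borel_measurable_integrable[of lborel "monogenic_exponential y z'"]
    by (simp add: has_bochner_integral_iff integrable_completion integral_completion)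
  have E_meas: "monogenic_exponential y z \<in> borel_measurable lebesgue"
    using E[of z] by (auto simp: has_bochner_integral_iff intro: borel_measurable_integrable)
  have w_meas: "w \<in> borel_measurable lebesgue"
    using w by (rule borel_measurable_integrable)
  have meas: "case_prod f \<in> borel_measurable (lebesgue \<Otimes>\<^sub>M lebesgue)"
    unfolding f_def case_prod_beta
  proof (rule borel_measurable_bilinear[OF bounded_bilinear_cmult])
    show "(\<lambda>p. monogenic_exponential y z (fst p)) \<in> borel_measurable (lebesgue \<Otimes>\<^sub>M lebesgue)"
      by (rule measurable_compose[OF measurable_fst E_meas])
    show "(\<lambda>p. cis (- (s (snd p) \<bullet> fst p)) *s w (snd p)) \<in> borel_measurable (lebesgue \<Otimes>\<^sub>M lebesgue)"
    proof (rule borel_measurable_bilinear[OF bounded_bilinear_vector_scale])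
      show "(\<lambda>p. w (snd p)) \<in> borel_measurable (lebesgue \<Otimes>\<^sub>M lebesgue)"
        by (rule measurable_compose[OF measurable_snd w_meas])
      have "(\<lambda>p. s (snd p) \<bullet> fst p) \<in> borel_measurable (lebesgue \<Otimes>\<^sub>M lebesgue)"
        by (intro borel_measurable_inner measurable_compose[OF borel_measurable_lebesgue_pair(2) s] borel_measurable_lebesgue_pair(1))
      then show "(\<lambda>p. cis (- (s (snd p) \<bullet> fst p))) \<in> borel_measurable (lebesgue \<Otimes>\<^sub>M lebesgue)"
        by (intro measurable_compose[OF _ borel_measurable_cis] borel_measurable_uminus)
    qed
  qed
  have g: "integrable lebesgue (\<lambda>\<xi>::(real, 'n) vec. exp (- y * norm \<xi>))"
    using integrable_exp_minus_norm[OF y, where 'a = "(real, 'n) vec"] by (simp add: integrable_completion)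
  have "integrable (lebesgue \<Otimes>\<^sub>M lebesgue) (\<lambda>p. (2 * K * exp (- y * norm (fst p :: (real, 'n) vec))) * norm (w (snd p)))"
    by (intro integrable_lebesgue_pair_mult integrable_mult_right g integrable_norm w)
  then have int: "integrable (lebesgue \<Otimes>\<^sub>M lebesgue) (case_prod f)"
  proof (rule Bochner_Integration.integrable_bound[OF _ meas])
    have "norm (f \<xi> t) \<le> (2 * K * exp (- y * norm \<xi>)) * norm (w t)" for \<xi> t
    proof -
      have "norm (f \<xi> t) \<le> norm (monogenic_exponential y z \<xi>) * norm (w t) * K"
        using K(2)[of "monogenic_exponential y z \<xi>" "cis (- (s t \<bullet> \<xi>)) *s w t"]
        by (simp add: f_def norm_vector_scale)
      also have "\<dots> \<le> (2 * exp (- y * norm \<xi>)) * norm (w t) * K"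
        using K(1) by (intro mult_right_mono norm_monogenic_exponential_le) auto
      finally show ?thesis by (simp only: mult_ac)
    qed
    then show "AE p in lebesgue \<Otimes>\<^sub>M lebesgue. norm (case_prod f p) \<le> norm ((2 * K * exp (- y * norm (fst p))) * norm (w (snd p)))"
      by (intro AE_I2) (auto intro: order_trans[OF _ abs_ge_self])
  qed
  have "(LINT \<xi>|lebesgue. monogenic_exponential y z \<xi> \<odot> (LINT t|lebesgue. cis (- (s t \<bullet> \<xi>)) *s w t)) =
      (LINT \<xi>|lebesgue. LINT t|lebesgue. f \<xi> t)"
  proof (rule Bochner_Integration.integral_cong[OF refl])
    fix \<xi> :: "(real, 'n) vec"
    have "(\<lambda>t. cis (- (s t \<bullet> \<xi>))) \<in> borel_measurable lebesgue"
      by (intro borel_measurable_lebesgue_if_borel measurable_compose[OF _ borel_measurable_cis]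
          borel_measurable_uminus borel_measurable_inner s) simp
    then have "integrable lebesgue (\<lambda>t. cis (- (s t \<bullet> \<xi>)) *s w t)"
      by (intro integrable_phase w) simp_all
    then show "monogenic_exponential y z \<xi> \<odot> (LINT t|lebesgue. cis (- (s t \<bullet> \<xi>)) *s w t) = (LINT t|lebesgue. f \<xi> t)"
      unfolding f_def by (rule integral_bounded_linear[OF cm.bounded_linear_right, symmetric])
  qed
  also have "\<dots> = (LINT t|lebesgue. LINT \<xi>|lebesgue. f \<xi> t)"
    by (rule lebesgue_pair.Fubini_integral[OF int, symmetric])
  also have "\<dots> = (LINT t|lebesgue. (2 * pi) ^ CARD('n) *\<^sub>R (cauchy_kernel y (z - s t) \<odot> w t))"
  proof (rule Bochner_Integration.integral_cong[OF refl])
    fix t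
    have "has_bochner_integral lebesgue (\<lambda>\<xi>. monogenic_exponential y (z - s t) \<xi> \<odot> w t)
        (((2 * pi) ^ CARD('n) *\<^sub>R cauchy_kernel y (z - s t)) \<odot> w t)"
      by (rule has_bochner_integral_bounded_linear[OF cm.bounded_linear_left E])
    then show "(LINT \<xi>|lebesgue. f \<xi> t) = (2 * pi) ^ CARD('n) *\<^sub>R (cauchy_kernel y (z - s t) \<odot> w t)"
      unfolding f_eq cm.scaleR_left[symmetric] by (rule has_bochner_integral_integral_eq)
  qed
  finally show ?thesis .
qed

text \<open>
  For the principal branch the two square roots are complex conjugates of each other.
\<close>

lemma csqrt_mult_csqrt_minus:
  assumes "r > 0"
  shows "csqrt (\<i> * complex_of_real r) * csqrt (- \<i> * complex_of_real r) = complex_of_real r"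
proof -
  define q where "q = sqrt (r / 2)"
  have q: "q > 0" "complex_of_real q ^ 2 = complex_of_real (r / 2)"
    using assms by (auto simp: q_def simp flip: of_real_power)
  have "csqrt (\<i> * complex_of_real r) = complex_of_real q * (1 + \<i>)"
    using q by (intro csqrt_unique) (auto simp: power_mult_distrib power2_sum)
  moreover have "csqrt (- \<i> * complex_of_real r) = complex_of_real q * (1 - \<i>)"
    using q by (intro csqrt_unique) (auto simp: power_mult_distrib power2_diff)
  moreover have "complex_of_real q * (1 + \<i>) * (complex_of_real q * (1 - \<i>)) = complex_of_real q ^ 2 * 2"
    by (simp add: power2_eq_square algebra_simps)
  ultimately show ?thesis
    by (simp add: q(2))
qed

lemma square_integrable_phase:
  fixes c :: "'x::euclidean_space \<Rightarrow> complex" and u :: "'x \<Rightarrow> complex ^ 'm::finite"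
  assumes "square_integrable u" "c \<in> borel_measurable lebesgue" "\<And>t. cmod (c t) = 1"
  shows "square_integrable (\<lambda>t. c t *s u t)"
  using assms borel_measurable_bilinear[OF bounded_bilinear_vector_scale assms(2), of u]
  by (simp add: square_integrable_def norm_vector_scale)

lemma lct_borel_measurable:
  fixes u :: "real ^ 'n::{finite,linorder} \<Rightarrow> 'n clifford"
  assumes u: "u \<in> borel_measurable lebesgue"
  shows "lct a b c d u \<in> borel_measurable lebesgue"
  unfolding lct_def[abs_def]
proof (rule sigma_finite_measure.borel_measurable_lebesgue_integral[OF sigma_finite_lebesgue])
  note [measurable] = borel_measurable_lebesgue_pair
  show "case_prod (\<lambda>\<xi> x. (1 / csqrt (\<i> * 2 * pi * b) ^ CARD('n) *
       exp (\<i> * complex_of_real (d / (2 * b) * (norm \<xi>)\<^sup>2 - 1 / b * (\<xi> \<bullet> x)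
                               + a / (2 * b) * (norm x)\<^sup>2))) *s u x)
     \<in> borel_measurable (lebesgue \<Otimes>\<^sub>M lebesgue)"
    unfolding case_prod_beta
  proof (rule borel_measurable_bilinear[OF bounded_bilinear_vector_scale])
    show "(\<lambda>p. u (snd p)) \<in> borel_measurable (lebesgue \<Otimes>\<^sub>M lebesgue)"
      by (rule measurable_compose[OF measurable_snd u])
  qed measurable
qed

theorem theorem2p4:
  fixes a b c d :: real
    and f F g :: "real ^ 'n::{finite,linorder} \<Rightarrow> 'n clifford"
    and x0 :: real and x :: "real ^ 'n::{finite,linorder}"
  assumes "a * d - b * c = 1" and "b > 0"
    and "square_integrable f"
    and "is_lct_L2 a b c d f F" and "integrable lebesgue F"
    and "\<And>t. g t = exp (\<i> * complex_of_real (a / (2 * b) * (norm t)\<^sup>2)) *s f t"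
    and "x0 > 0"
  shows "monogenic_lct a b d F x0 x =
    exp (- \<i> * complex_of_real (a / (2 * b) * (norm (paravec x0 x))\<^sup>2)) *s
      (poisson_ext g x0 x + conj_poisson_ext g x0 x)"
proof -
  define y where "y = x0 / b"
  define z where "z = x /\<^sub>R b"
  define e where "e \<xi> = exp (- \<i> * complex_of_real (d / (2 * b) * (norm \<xi>)\<^sup>2))" for \<xi> :: "(real, 'n) vec"
  define chirp where "chirp t = exp (\<i> * complex_of_real (a / (2 * b) * (norm t)\<^sup>2))" for t :: "(real, 'n) vec"
  define C where "C = 1 / csqrt (\<i> * 2 * pi * b) ^ CARD('n)"
  define D where "D = csqrt (- \<i> * 2 * pi * b) ^ CARD('n)"
  \<comment> \<open>The factor \<open>(2\<pi>)\<^sup>n\<close> comes from the Fourier transform, \<open>b\<^sup>n\<close> from rescaling the kernel from \<open>(x - t)/b\<close> to \<open>x - t\<close>.\<close>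
  define m where "m = (2 * pi) ^ CARD('n) * b ^ CARD('n)"
  interpret cm: bounded_bilinear "(\<odot>) :: 'n clifford \<Rightarrow> 'n clifford \<Rightarrow> 'n clifford"
    by (rule bounded_bilinear_cmult)
  interpret sc: bounded_bilinear "(*s) :: complex \<Rightarrow> 'n clifford \<Rightarrow> 'n clifford"
    by (rule bounded_bilinear_vector_scale)
  have b: "b > 0" and x0: "x0 > 0" and y: "y > 0"
    using assms(2,7) by (simp_all add: y_def)
  have e: "cmod (e \<xi>) = 1" and chirp: "cmod (chirp \<xi>) = 1" for \<xi>
    using norm_exp_i_times[of "- (d / (2 * b) * (norm \<xi>)\<^sup>2)"] norm_exp_i_times[of "a / (2 * b) * (norm \<xi>)\<^sup>2"]
    by (simp_all add: e_def chirp_def)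
  have e_meas: "e \<in> borel_measurable lebesgue" and chirp_meas: "chirp \<in> borel_measurable lebesgue"
    unfolding e_def[abs_def] chirp_def[abs_def] by (rule borel_measurable_lebesgue_if_borel, measurable)+
  obtain u where u: "\<And>k. integrable lebesgue (u k)" "\<And>k. square_integrable (u k)"
    and u_f: "(\<lambda>k. \<integral>\<^sup>+x. ennreal ((norm (u k x - f x))\<^sup>2) \<partial>lebesgue) \<longlonglongrightarrow> 0"
    and u_F: "(\<lambda>k. \<integral>\<^sup>+\<xi>. ennreal ((norm (lct a b c d (u k) \<xi> - F \<xi>))\<^sup>2) \<partial>lebesgue) \<longlonglongrightarrow> 0"
    and F: "square_integrable F"
    using assms(4) unfolding is_lct_L2_def by blast
  have kernel: "square_integrable (\<lambda>t. cauchy_kernel x0 (x - t))"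
    "square_integrable (\<lambda>t. poisson_kernel x0 (x - t))"
    "square_integrable (\<lambda>t. conj_poisson_kernel x0 (x - t))"
    by (rule square_integrable_poisson_decay[OF x0 _ norm_poisson_kernels_le(1)[OF x0]]
        square_integrable_poisson_decay[OF x0 _ norm_poisson_kernels_le(2)[OF x0]]
        square_integrable_poisson_decay[OF x0 _ norm_poisson_kernels_le(3)[OF x0]], measurable)+
  have g_eq: "g = (\<lambda>t. chirp t *s f t)"
    using assms(6) by (simp add: chirp_def fun_eq_iff)
  have g: "square_integrable g"
    unfolding g_eq by (rule square_integrable_phase[OF assms(3) chirp_meas chirp])
  have iso: "(norm (r *s v - r *s w))\<^sup>2 = (norm (v - w))\<^sup>2" if "cmod r = 1" for r and v w :: "'n clifford"
    unfolding vec.scale_right_diff_distrib[symmetric] norm_vector_scale that by simp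
  define S where "S = (LINT t|lebesgue. cauchy_kernel x0 (x - t) \<odot> g t)"
  \<comment> \<open>The same quantity is computed on both sides of the approximation: \<open>limF\<close> on the transform side, \<open>limg\<close> on the side of \<open>g\<close>.\<close>
  have limF: "(\<lambda>k. LINT \<xi>|lebesgue. monogenic_exponential y z \<xi> \<odot> (e \<xi> *s lct a b c d (u k) \<xi>))
      \<longlonglongrightarrow> (LINT \<xi>|lebesgue. monogenic_exponential y z \<xi> \<odot> (e \<xi> *s F \<xi>))"
  proof (rule tendsto_integral_bilinear_square_integrable[OF bounded_bilinear_cmult])
    show "square_integrable (monogenic_exponential y z)"
      by (rule square_integrable_monogenic_exponential[OF y])
    show "square_integrable (\<lambda>\<xi>. e \<xi> *s F \<xi>)"
      by (rule square_integrable_phase[OF F e_meas e])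
    show "(\<lambda>\<xi>. e \<xi> *s lct a b c d (u k) \<xi>) \<in> borel_measurable lebesgue" for k
      by (rule borel_measurable_bilinear[OF bounded_bilinear_vector_scale e_meas
            lct_borel_measurable[OF borel_measurable_integrable[OF u(1)]]])
    show "(\<lambda>k. \<integral>\<^sup>+\<xi>. ennreal ((norm (e \<xi> *s lct a b c d (u k) \<xi> - e \<xi> *s F \<xi>))\<^sup>2) \<partial>lebesgue) \<longlonglongrightarrow> 0"
      unfolding iso[OF e] by (rule u_F)
  qed
  have limg: "(\<lambda>k. LINT t|lebesgue. cauchy_kernel x0 (x - t) \<odot> (chirp t *s u k t)) \<longlonglongrightarrow> S"
    unfolding S_def
  proof (rule tendsto_integral_bilinear_square_integrable[OF bounded_bilinear_cmult kernel(1) g])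
    show "(\<lambda>t. chirp t *s u k t) \<in> borel_measurable lebesgue" for k
      by (rule borel_measurable_integrable[OF integrable_phase[OF u(1) chirp_meas chirp]])
    show "(\<lambda>k. \<integral>\<^sup>+t. ennreal ((norm (chirp t *s u k t - g t))\<^sup>2) \<partial>lebesgue) \<longlonglongrightarrow> 0"
      unfolding g_eq iso[OF chirp] by (rule u_f)
  qed
  have approx: "(LINT \<xi>|lebesgue. monogenic_exponential y z \<xi> \<odot> (e \<xi> *s lct a b c d (u k) \<xi>)) =
      m *\<^sub>R (C *s (LINT t|lebesgue. cauchy_kernel x0 (x - t) \<odot> (chirp t *s u k t)))" for k
  proof -
    have "(LINT \<xi>|lebesgue. monogenic_exponential y z \<xi> \<odot> (e \<xi> *s lct a b c d (u k) \<xi>)) =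
        (LINT \<xi>|lebesgue. monogenic_exponential y z \<xi> \<odot>
          (LINT t|lebesgue. cis (- ((t /\<^sub>R b) \<bullet> \<xi>)) *s (C *s (chirp t *s u k t))))"
      unfolding e_def lct_eq_fourier[OF u(1)] C_def chirp_def ..
    also have "\<dots> = (LINT t|lebesgue. (2 * pi) ^ CARD('n) *\<^sub>R (cauchy_kernel y (z - t /\<^sub>R b) \<odot> (C *s (chirp t *s u k t))))"
      by (intro monogenic_exponential_fubini y
           integrable_bounded_linear[OF sc.bounded_linear_right integrable_phase[OF u(1) chirp_meas chirp]]) simp
    also have "\<dots> = (LINT t|lebesgue. m *\<^sub>R (C *s (cauchy_kernel x0 (x - t) \<odot> (chirp t *s u k t))))"
    proof -
      have "cauchy_kernel y (z - t /\<^sub>R b) = b ^ CARD('n) *\<^sub>R cauchy_kernel x0 (x - t)" for t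
        unfolding y_def z_def scaleR_diff_right[symmetric] by (rule cauchy_kernel_scale[OF b])
      then show ?thesis
        by (simp only: m_def scaleR_eq_vector_scale cmult_scale_left cmult_scale_right vec.scale_scale
            of_real_mult mult_ac)
    qed
    also have "\<dots> = m *\<^sub>R (LINT t|lebesgue. C *s (cauchy_kernel x0 (x - t) \<odot> (chirp t *s u k t)))"
      by (rule integral_scaleR_right)
    also have "(LINT t|lebesgue. C *s (cauchy_kernel x0 (x - t) \<odot> (chirp t *s u k t))) =
        C *s (LINT t|lebesgue. cauchy_kernel x0 (x - t) \<odot> (chirp t *s u k t))"
      by (intro integral_bounded_linear[OF sc.bounded_linear_right]
           integrable_bilinear_square_integrable[OF bounded_bilinear_cmult kernel(1)]
           square_integrable_phase[OF u(2) chirp_meas chirp])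
    finally show ?thesis .
  qed
  have "(\<lambda>k. m *\<^sub>R (C *s (LINT t|lebesgue. cauchy_kernel x0 (x - t) \<odot> (chirp t *s u k t)))) \<longlonglongrightarrow> m *\<^sub>R (C *s S)"
    by (intro tendsto_scaleR sc.tendsto tendsto_const limg)
  then have transform: "(LINT \<xi>|lebesgue. monogenic_exponential y z \<xi> \<odot> (e \<xi> *s F \<xi>)) = m *\<^sub>R (C *s S)"
    using limF unfolding approx by (rule LIMSEQ_unique[rotated])
  have S: "S = poisson_ext g x0 x + conj_poisson_ext g x0 x"
    unfolding S_def poisson_ext_def conj_poisson_ext_def cauchy_kernel_cmult
    by (intro Bochner_Integration.integral_add integrable_bilinear_square_integrable[OF bounded_bilinear_scaleR kernel(2) g]
         integrable_bilinear_square_integrable[OF bounded_bilinear_cmult kernel(3) g])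
  have const: "complex_of_real m * C / D = 1"
  proof -
    have "csqrt (\<i> * 2 * pi * b) * csqrt (- \<i> * 2 * pi * b) = complex_of_real (2 * pi * b)"
      using csqrt_mult_csqrt_minus[of "2 * pi * b"] b by (simp add: mult.assoc)
    then have "csqrt (\<i> * 2 * pi * b) ^ CARD('n) * D = complex_of_real m"
      unfolding D_def m_def by (simp only: power_mult_distrib[symmetric] of_real_power)
    moreover have "complex_of_real m \<noteq> 0"
      using b by (simp add: m_def)
    ultimately show ?thesis
      by (simp add: C_def)
  qed
  have "monogenic_lct a b d F x0 x =
      (exp (- \<i> * complex_of_real (a / (2 * b) * (norm (paravec x0 x))\<^sup>2)) / D) *s
      (LINT \<xi>|lebesgue. monogenic_exponential y z \<xi> \<odot> (e \<xi> *s F \<xi>))"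
  proof -
    have "exp (complex_of_real (- (x0 / b) * norm \<xi>)) * exp (\<i> * complex_of_real (1 / b * (x \<bullet> \<xi>))) =
        complex_of_real (exp (- y * norm \<xi>)) * cis (z \<bullet> \<xi>)" for \<xi>
      by (simp only: exp_of_real y_def z_def cis_conv_exp inner_scaleR_left inverse_eq_divide)
    then show ?thesis
      unfolding monogenic_lct_def D_def e_def monogenic_exponential_def by (simp only: cmult_scale_left)
  qed
  also have "\<dots> = (exp (- \<i> * complex_of_real (a / (2 * b) * (norm (paravec x0 x))\<^sup>2)) * (complex_of_real m * C / D)) *s S"
    unfolding transform scaleR_eq_vector_scale vec.scale_scale by (simp only: divide_inverse mult_ac)
  finally show ?thesis
    unfolding const S by simp
qed

end
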